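(* Let $\Omega$ be a bounded open set of $\mathbb{R}^N$ with Lipschitz boundary and let $f:\mathbb{R}^{d\times N}\to\overline{\mathbb{R}}$ be a Borel function such that for every $\lambda>\inf_{\mathbb{R}^{d\times N}}f$ the sublevel set $L_\lambda(f)=\{\xi\in\mathbb{R}^{d\times N}: f(\xi)\le\lambda\}$ is convex and has nonempty interior. Let $F:W^{1,\infty}(\Omega;\mathbb{R}^d)\to\overline{\mathbb{R}}$ be the supremal functional $$F(u):=\operatorname*{ess\,sup}_{x\in\Omega} f(\nabla u(x)).$$ Then $$\Gamma_{w*}(F)(u)=\Gamma_{w^*_{seq}}(F)(u)=\operatorname*{ess\,sup}_{x\in\Omega} f^{ls}(\nabla u(x))\qquad\text{for every } u\in W^{1,\infty}(\Omega;\mathbb{R}^d),$$ where $f^{ls}$ denotes the lower semicontinuous envelope of $f$.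
   Context: $\overline{\mathbb{R}}=[-\infty,+\infty]$; $\lambda$ ranges over real numbers. $f^{ls}:\mathbb{R}^{d\times N}\to\overline{\mathbb{R}}$ is the greatest lower semicontinuous function less than or equal to $f$ (for the usual topology of $\mathbb{R}^{d\times N}$). $w^*$ denotes the weak* topology of $W^{1,\infty}(\Omega;\mathbb{R}^d)$ (i.e. the topology induced by the embedding $u\mapsto(u,\nabla u)$ into $L^\infty(\Omega;\mathbb{R}^d)\times L^\infty(\Omega;\mathbb{R}^{d\times N})$ endowed with its weak* topology), and $w^*_{seq}$ the associated sequential topology (the one whose closed sets are the sequentially weakly* closed sets). For a topology $\tau$ on a space $X$ and $F:X\to\overline{\mathbb{R}}$, the lower semicontinuous envelope is $\Gamma_\tau(F):=\sup\{G \mid G:X\to\overline{\mathbb{R}} \text{ is } \tau\text{-lower semicontinuous and } G\le F \text{ on } X\}$. Thus $\Gamma_{w*}(F)$ is the greatest weakly* lower semicontinuous functional $\le F$, and $\Gamma_{w^*_{seq}}(F)$ is the greatest sequentially weakly* lower semicontinuous functional $\le F$. *)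

theory Defs
  imports "HOL-Analysis.Analysis" "HOL-Probability.Essential_Supremum"
begin

section \<open>Semicontinuity and envelopes\<close>

definition lower_semicontinuous_map :: "'a topology \<Rightarrow> ('a \<Rightarrow> ereal) \<Rightarrow> bool" where
  "lower_semicontinuous_map T G \<longleftrightarrow> (\<forall>a. openin T {x \<in> topspace T. a < G x})"

text \<open>The constant \<open>-\<infinity>\<close> is always admissible, so the supremum is over a nonempty set.\<close>

definition lsc_envelope :: "'a topology \<Rightarrow> ('a \<Rightarrow> ereal) \<Rightarrow> 'a \<Rightarrow> ereal" where
  "lsc_envelope T F x =
     (SUP G \<in> {G. lower_semicontinuous_map T G \<and> (\<forall>y \<in> topspace T. G y \<le> F y)}. G x)"

definition sequentially_closedin :: "'a topology \<Rightarrow> 'a set \<Rightarrow> bool" where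
  "sequentially_closedin T C \<longleftrightarrow>
     C \<subseteq> topspace T \<and> (\<forall>\<sigma> l. (\<forall>n. \<sigma> n \<in> C) \<and> limitin T \<sigma> l sequentially \<longrightarrow> l \<in> C)"

definition sequential_topology :: "'a topology \<Rightarrow> 'a topology" where
  "sequential_topology T =
     topology (\<lambda>U. U \<subseteq> topspace T \<and> sequentially_closedin T (topspace T - U))"

lemma sequentially_closedin_Un:
  assumes C: "sequentially_closedin T C" and D: "sequentially_closedin T D"
  shows "sequentially_closedin T (C \<union> D)"
  unfolding sequentially_closedin_def
proof (intro conjI allI impI)
  show "C \<union> D \<subseteq> topspace T"
    using C D by (auto simp: sequentially_closedin_def)
  have *: "l \<in> E" if E: "sequentially_closedin T E" and inf: "infinite {n. \<sigma> n \<in> E}"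
    and lim: "limitin T \<sigma> l sequentially" for \<sigma> :: "nat \<Rightarrow> 'a" and l E
  proof -
    obtain r :: "nat \<Rightarrow> nat" where r: "strict_mono r" "\<And>n. r n \<in> {n. \<sigma> n \<in> E}"
      using infinite_enumerate[OF inf] by blast
    have "limitin T (\<sigma> \<circ> r) l sequentially"
      by (rule limitin_subsequence[OF r(1) lim])
    moreover have "\<forall>n. (\<sigma> \<circ> r) n \<in> E" using r(2) by simp
    ultimately show ?thesis
      using E unfolding sequentially_closedin_def by blast
  qed
  fix \<sigma> :: "nat \<Rightarrow> 'a" and l
  assume "(\<forall>n. \<sigma> n \<in> C \<union> D) \<and> limitin T \<sigma> l sequentially"
  then have m: "\<And>n. \<sigma> n \<in> C \<union> D" and l: "limitin T \<sigma> l sequentially" by auto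
  have "{n. \<sigma> n \<in> C} \<union> {n. \<sigma> n \<in> D} = UNIV" using m by auto
  then have "infinite {n. \<sigma> n \<in> C} \<or> infinite {n. \<sigma> n \<in> D}"
    by (metis finite_Un infinite_UNIV_nat)
  then show "l \<in> C \<union> D" using *[OF C] *[OF D] l by blast
qed

lemma openin_sequential_topology:
  "openin (sequential_topology T) U \<longleftrightarrow>
     U \<subseteq> topspace T \<and> sequentially_closedin T (topspace T - U)"
proof -
  have "istopology (\<lambda>U. U \<subseteq> topspace T \<and> sequentially_closedin T (topspace T - U))"
    unfolding istopology_def
  proof (intro conjI allI impI)
    fix S V
    assume "S \<subseteq> topspace T \<and> sequentially_closedin T (topspace T - S)"
      and "V \<subseteq> topspace T \<and> sequentially_closedin T (topspace T - V)"
    then show "S \<inter> V \<subseteq> topspace T" and "sequentially_closedin T (topspace T - S \<inter> V)"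
      by (blast, simp add: Diff_Int sequentially_closedin_Un)
  next
    fix K
    assume *: "\<forall>S\<in>K. S \<subseteq> topspace T \<and> sequentially_closedin T (topspace T - S)"
    then have K: "\<And>S. S \<in> K \<Longrightarrow> sequentially_closedin T (topspace T - S)" by blast
    show "\<Union> K \<subseteq> topspace T"
      using * by blast
    show "sequentially_closedin T (topspace T - \<Union> K)"
      unfolding sequentially_closedin_def
    proof (intro conjI allI impI)
      fix \<sigma> :: "nat \<Rightarrow> 'a" and l
      assume \<sigma>: "(\<forall>n. \<sigma> n \<in> topspace T - \<Union> K) \<and> limitin T \<sigma> l sequentially"
      have "l \<in> topspace T - S" if "S \<in> K" for S
      proof -
        have "\<forall>n. \<sigma> n \<in> topspace T - S" using \<sigma> that by blast
        then show ?thesis using K[OF that] \<sigma> unfolding sequentially_closedin_def by blast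
      qed
      moreover have "l \<in> topspace T" using \<sigma> by (simp add: limitin_def)
      ultimately show "l \<in> topspace T - \<Union> K" by blast
    qed simp
  qed
  then show ?thesis
    by (simp add: sequential_topology_def topology_inverse')
qed

lemma topspace_sequential_topology [simp]: "topspace (sequential_topology T) = topspace T"
proof -
  have "openin (sequential_topology T) (topspace T)"
    by (auto simp: openin_sequential_topology sequentially_closedin_def)
  then have "topspace T \<subseteq> topspace (sequential_topology T)" by (rule openin_subset)
  moreover have "openin (sequential_topology T) (topspace (sequential_topology T))" by simp
  then have "topspace (sequential_topology T) \<subseteq> topspace T"
    unfolding openin_sequential_topology by blast
  ultimately show ?thesis by blast
qed

lemma closedin_sequential_topology:
  "closedin (sequential_topology T) C \<longleftrightarrow> sequentially_closedin T C"
proof -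
  have "C \<subseteq> topspace T" if "sequentially_closedin T C"
    using that by (simp add: sequentially_closedin_def)
  then show ?thesis
    by (auto simp: closedin_def openin_sequential_topology double_diff)
qed

section \<open>Domains with Lipschitz boundary\<close>

text \<open>
  Near each boundary point, \<open>\<Omega>\<close> is the strict epigraph, in the direction of some unit
  vector \<open>e\<close>, of a Lipschitz function on the hyperplane orthogonal to \<open>e\<close>.
\<close>

definition lipschitz_boundary :: "'a::euclidean_space set \<Rightarrow> bool" where
  "lipschitz_boundary \<Omega> \<longleftrightarrow>
     (\<forall>p \<in> frontier \<Omega>. \<exists>r>0. \<exists>e. norm e = 1 \<and> (\<exists>\<gamma>::'a \<Rightarrow> real. \<exists>L.
        L-lipschitz_on {y. y \<bullet> e = 0} \<gamma> \<and>
        \<Omega> \<inter> ball p r = {x \<in> ball p r. \<gamma> (x - (x \<bullet> e) *\<^sub>R e) < x \<bullet> e}))"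

section \<open>The space \<open>L\<^sup>\<infinity>\<close> and its weak* topology\<close>

text \<open>
  As usual in the library, the elements of \<open>L\<^sup>\<infinity>\<close> and of the Sobolev space below are functions
  rather than classes modulo a.e. equality. The topologies are the preimages of the ones on
  classes: a.e. equal functions lie in the same open sets, and lower semicontinuous
  functionals are constant on classes; see the lemmas at the end.
\<close>

definition Linfty :: "'a::euclidean_space set \<Rightarrow> ('a \<Rightarrow> 'b::euclidean_space) set" where
  "Linfty \<Omega> = {g \<in> borel_measurable (lebesgue_on \<Omega>). \<exists>C. AE x in lebesgue_on \<Omega>. norm (g x) \<le> C}"

text \<open>The coarsest topology making \<open>g \<mapsto> \<integral>\<^sub>\<Omega> g \<bullet> \<phi>\<close> continuous for every integrable \<open>\<phi>\<close>.\<close>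

definition Linfty_weak_star ::
    "'a::euclidean_space set \<Rightarrow> ('a \<Rightarrow> 'b::euclidean_space) topology" where
  "Linfty_weak_star \<Omega> = topology_generated_by
     {{g \<in> Linfty \<Omega>. (LINT x|lebesgue_on \<Omega>. g x \<bullet> \<phi> x) \<in> V} | \<phi> V.
        integrable (lebesgue_on \<Omega>) \<phi> \<and> open V}"

section \<open>The space \<open>W\<^bsup>1,\<infinity>\<^esup>\<close> and its weak* topology\<close>

definition partial_derivative :: "'n::finite \<Rightarrow> (real^'n \<Rightarrow> real) \<Rightarrow> real^'n \<Rightarrow> real" where
  "partial_derivative j \<phi> x = frechet_derivative \<phi> (at x) (axis j 1)"

primrec times_continuously_differentiable :: "nat \<Rightarrow> (real^'n::finite \<Rightarrow> real) \<Rightarrow> bool" where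
  "times_continuously_differentiable 0 \<phi> \<longleftrightarrow> continuous_on UNIV \<phi>"
| "times_continuously_differentiable (Suc k) \<phi> \<longleftrightarrow>
     (\<forall>x. \<phi> differentiable at x) \<and>
     (\<forall>j. times_continuously_differentiable k (partial_derivative j \<phi>))"

text \<open>Test functions on \<open>\<Omega>\<close> are extended by zero to the whole space.\<close>

definition test_functions :: "(real^'n::finite) set \<Rightarrow> (real^'n \<Rightarrow> real) set" where
  "test_functions \<Omega> = {\<phi>. (\<forall>k. times_continuously_differentiable k \<phi>) \<and>
     compact (closure {x. \<phi> x \<noteq> 0}) \<and> closure {x. \<phi> x \<noteq> 0} \<subseteq> \<Omega>}"

definition is_weak_gradient ::
    "(real^'n::finite) set \<Rightarrow> (real^'n \<Rightarrow> real^'d::finite) \<Rightarrow> (real^'n \<Rightarrow> real^'n^'d) \<Rightarrow> bool" where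
  "is_weak_gradient \<Omega> u Du \<longleftrightarrow> (\<forall>\<phi> \<in> test_functions \<Omega>. \<forall>i j.
     (LINT x|lebesgue_on \<Omega>. u x $ i * partial_derivative j \<phi> x) =
     - (LINT x|lebesgue_on \<Omega>. Du x $ i $ j * \<phi> x))"

definition W1infty :: "(real^'n::finite) set \<Rightarrow> (real^'n \<Rightarrow> real^'d::finite) set" where
  "W1infty \<Omega> = {u \<in> Linfty \<Omega>. \<exists>Du \<in> Linfty \<Omega>. is_weak_gradient \<Omega> u Du}"

text \<open>The weak gradient is only determined up to a.e. equality; this picks one representative.\<close>

definition weak_gradient ::
    "(real^'n::finite) set \<Rightarrow> (real^'n \<Rightarrow> real^'d::finite) \<Rightarrow> real^'n \<Rightarrow> real^'n^'d" where
  "weak_gradient \<Omega> u = (SOME Du. Du \<in> Linfty \<Omega> \<and> is_weak_gradient \<Omega> u Du)"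

definition W1infty_weak_star ::
    "(real^'n::finite) set \<Rightarrow> (real^'n \<Rightarrow> real^'d::finite) topology" where
  "W1infty_weak_star \<Omega> = pullback_topology (W1infty \<Omega>) (\<lambda>u. (u, weak_gradient \<Omega> u))
     (prod_topology (Linfty_weak_star \<Omega>) (Linfty_weak_star \<Omega>))"

definition supremal_functional ::
    "(real^'n::finite) set \<Rightarrow> (real^'n^'d::finite \<Rightarrow> ereal) \<Rightarrow> (real^'n \<Rightarrow> real^'d) \<Rightarrow> ereal" where
  "supremal_functional \<Omega> f u = esssup (lebesgue_on \<Omega>) (\<lambda>x. f (weak_gradient \<Omega> u x))"

section \<open>Basic facts\<close>

lemma topspace_Linfty_weak_star [simp]:
  "topspace (Linfty_weak_star \<Omega> :: ('a::euclidean_space \<Rightarrow> 'b::euclidean_space) topology) = Linfty \<Omega>"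
proof -
  let ?B = "\<lambda>(\<phi>::'a \<Rightarrow> 'b) V. {g \<in> Linfty \<Omega>. (LINT x|lebesgue_on \<Omega>. g x \<bullet> \<phi> x) \<in> V}"
  have "Linfty \<Omega> = ?B (\<lambda>_. 0) UNIV" by simp
  moreover have "integrable (lebesgue_on \<Omega>) (\<lambda>_. 0::'b)" by simp
  ultimately have "Linfty \<Omega> \<in> {?B \<phi> V | \<phi> V. integrable (lebesgue_on \<Omega>) \<phi> \<and> open V}"
    using open_UNIV by blast
  moreover have "\<Union> {?B \<phi> V | \<phi> V. integrable (lebesgue_on \<Omega>) \<phi> \<and> open V} \<subseteq> Linfty \<Omega>" by blast
  ultimately show ?thesis
    unfolding Linfty_weak_star_def topology_generated_by_topspace by (intro equalityI) (blast, rule Union_upper)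
qed

lemma weak_gradient:
  assumes "u \<in> W1infty \<Omega>"
  shows "weak_gradient \<Omega> u \<in> Linfty \<Omega>" "is_weak_gradient \<Omega> u (weak_gradient \<Omega> u)"
proof -
  have "\<exists>Du. Du \<in> Linfty \<Omega> \<and> is_weak_gradient \<Omega> u Du"
    using assms by (auto simp: W1infty_def)
  from someI_ex[OF this] show "weak_gradient \<Omega> u \<in> Linfty \<Omega>"
      "is_weak_gradient \<Omega> u (weak_gradient \<Omega> u)"
    by (simp_all add: weak_gradient_def)
qed

lemma topspace_W1infty_weak_star [simp]: "topspace (W1infty_weak_star \<Omega>) = W1infty \<Omega>"
  by (auto simp: W1infty_weak_star_def topspace_pullback_topology weak_gradient)
     (simp add: W1infty_def)

lemma Linfty_weak_star_AE_eq:
  assumes U: "openin (Linfty_weak_star \<Omega>) U" and g: "g \<in> U" and h: "h \<in> Linfty \<Omega>"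
    and eq: "AE x in lebesgue_on \<Omega>. g x = h x"
  shows "h \<in> U"
proof -
  have "generate_topology_on {{g \<in> Linfty \<Omega>. (LINT x|lebesgue_on \<Omega>. g x \<bullet> \<phi> x) \<in> V} | \<phi> V.
        integrable (lebesgue_on \<Omega>) \<phi> \<and> open V} U"
    using U unfolding Linfty_weak_star_def by (simp add: openin_topology_generated_by_iff)
  then show ?thesis using g
  proof induction
    case (Basis s)
    then obtain \<phi> V where s: "s = {g \<in> Linfty \<Omega>. (LINT x|lebesgue_on \<Omega>. g x \<bullet> \<phi> x) \<in> V}"
      and \<phi>: "integrable (lebesgue_on \<Omega>) \<phi>" by blast
    have g: "g \<in> Linfty \<Omega>" using Basis s by auto
    have [measurable]: "g \<in> borel_measurable (lebesgue_on \<Omega>)" "h \<in> borel_measurable (lebesgue_on \<Omega>)"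
        "\<phi> \<in> borel_measurable (lebesgue_on \<Omega>)"
      using g h \<phi> by (auto simp: Linfty_def)
    have "(LINT x|lebesgue_on \<Omega>. g x \<bullet> \<phi> x) = (LINT x|lebesgue_on \<Omega>. h x \<bullet> \<phi> x)"
      by (rule integral_cong_AE) (use eq in auto)
    then show ?case using Basis s h by auto
  qed auto
qed

lemma weak_gradient_AE_eq:
  assumes u: "u \<in> W1infty \<Omega>" and v: "v \<in> W1infty \<Omega>"
    and eq: "AE x in lebesgue_on \<Omega>. u x = v x"
  shows "weak_gradient \<Omega> u = weak_gradient \<Omega> v"
proof -
  have [measurable]: "u \<in> borel_measurable (lebesgue_on \<Omega>)" "v \<in> borel_measurable (lebesgue_on \<Omega>)"
    using u v by (auto simp: W1infty_def Linfty_def)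
  have "(LINT x|lebesgue_on \<Omega>. u x $ i * partial_derivative j \<phi> x) =
        (LINT x|lebesgue_on \<Omega>. v x $ i * partial_derivative j \<phi> x)"
    if "\<phi> \<in> test_functions \<Omega>" for \<phi> i j
  proof -
    have "times_continuously_differentiable (Suc 0) \<phi>"
      using that unfolding test_functions_def by blast
    then have "continuous_on UNIV (partial_derivative j \<phi>)" by simp
    then have "partial_derivative j \<phi> \<in> borel_measurable borel"
      by (rule borel_measurable_continuous_onI)
    then have [measurable]: "partial_derivative j \<phi> \<in> borel_measurable (lebesgue_on \<Omega>)"
      by (simp add: borel_measurable_if_D lebesgue_on_UNIV_eq measurable_completion
          measurable_restrict_space1)
    have [measurable]: "(\<lambda>x. u x $ i) \<in> borel_measurable (lebesgue_on \<Omega>)"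
        "(\<lambda>x. v x $ i) \<in> borel_measurable (lebesgue_on \<Omega>)"
      unfolding cart_eq_inner_axis by measurable
    show ?thesis
      by (rule integral_cong_AE) (use eq in auto)
  qed
  then have "is_weak_gradient \<Omega> u = is_weak_gradient \<Omega> v"
    by (auto simp: fun_eq_iff is_weak_gradient_def)
  then show ?thesis by (simp add: weak_gradient_def)
qed

lemma W1infty_weak_star_AE_eq:
  assumes U: "openin (W1infty_weak_star \<Omega>) U" and u: "u \<in> U" and v: "v \<in> W1infty \<Omega>"
    and eq: "AE x in lebesgue_on \<Omega>. u x = v x"
  shows "v \<in> U"
proof -
  let ?T = "Linfty_weak_star \<Omega>"
  obtain W where W: "openin (prod_topology ?T ?T) W"
    and UW: "U = (\<lambda>u. (u, weak_gradient \<Omega> u)) -` W \<inter> W1infty \<Omega>"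
    using U unfolding W1infty_weak_star_def openin_pullback_topology by blast
  have uW: "(u, weak_gradient \<Omega> u) \<in> W" and u': "u \<in> W1infty \<Omega>" using u UW by auto
  then obtain A B where AB: "openin ?T A" "openin ?T B" "u \<in> A" "weak_gradient \<Omega> u \<in> B"
      "A \<times> B \<subseteq> W"
    using W unfolding openin_prod_topology_alt by meson
  have "v \<in> A"
    using Linfty_weak_star_AE_eq[OF AB(1,3) _ eq] v by (auto simp: W1infty_def)
  then show ?thesis
    using AB weak_gradient_AE_eq[OF u' v eq] v UW by auto
qed

lemma lower_semicontinuous_map_sequential_topology:
  assumes "lower_semicontinuous_map T G"
  shows "lower_semicontinuous_map (sequential_topology T) G"
proof -
  have "sequentially_closedin T C" if "closedin T C" for C
    unfolding sequentially_closedin_def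
  proof (intro conjI allI impI)
    show "C \<subseteq> topspace T" using that by (rule closedin_subset)
    fix \<sigma> :: "nat \<Rightarrow> 'a" and l
    assume "(\<forall>n. \<sigma> n \<in> C) \<and> limitin T \<sigma> l sequentially"
    then show "l \<in> C"
      using limitin_closedin[OF _ that, of \<sigma> l sequentially] by simp
  qed
  then show ?thesis
    using assms unfolding lower_semicontinuous_map_def openin_sequential_topology
    by (auto simp: openin_closedin_eq)
qed

text \<open>
  Lower semicontinuous functionals for the sequential weak* topology, hence by the previous
  lemma also those for the weak* topology, are functionals on a.e. classes.
\<close>

lemma lower_semicontinuous_map_AE_eq:
  assumes G: "lower_semicontinuous_map (sequential_topology (W1infty_weak_star \<Omega>)) G"
    and uv: "u \<in> W1infty \<Omega>" "v \<in> W1infty \<Omega>" and eq: "AE x in lebesgue_on \<Omega>. u x = v x"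
  shows "G u = G v"
proof -
  let ?T = "W1infty_weak_star \<Omega>"
  have *: "G a \<le> G b" if ab: "a \<in> W1infty \<Omega>" "b \<in> W1infty \<Omega>"
    and eq: "AE x in lebesgue_on \<Omega>. a x = b x" for a b
  proof (rule ccontr)
    assume "\<not> G a \<le> G b"
    let ?U = "{x \<in> topspace ?T. G b < G x}"
    have "sequentially_closedin ?T (topspace ?T - ?U)"
      using G by (simp add: lower_semicontinuous_map_def openin_sequential_topology)
    moreover have "limitin ?T (\<lambda>_::nat. b) a sequentially"
      unfolding limitin_def
    proof (intro conjI allI impI)
      show "a \<in> topspace ?T" using ab by simp
      fix U assume U: "openin ?T U \<and> a \<in> U"
      have "b \<in> U" by (rule W1infty_weak_star_AE_eq[OF _ _ ab(2) eq]) (use U in auto)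
      then show "\<forall>\<^sub>F n::nat in sequentially. b \<in> U" by simp
    qed
    moreover have "\<forall>n::nat. b \<in> topspace ?T - ?U" using ab by simp
    ultimately have "a \<in> topspace ?T - ?U"
      unfolding sequentially_closedin_def by (elim conjE allE[of _ "\<lambda>_. b"] allE[of _ a]) (rule mp, assumption, rule conjI)
    then show False using \<open>\<not> G a \<le> G b\<close> ab by simp
  qed
  have "AE x in lebesgue_on \<Omega>. v x = u x" using eq by eventually_elim simp
  then show ?thesis using *[OF uv eq] *[OF uv(2,1)] by (simp add: order_antisym)
qed

end

theory Submission
  imports Defs
begin

text \<open>
  Sublevel sets of the envelope \<open>g\<close> of \<open>f\<close> are intersections of closures of sublevel sets of \<open>f\<close>,
  hence closed and convex. A closed convex set is a countable intersection of half-spaces, so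
  \<open>\<nabla>u \<in> K\<close> a.e. is a weakly* closed condition and \<open>u \<mapsto> ess sup g(\<nabla>u)\<close> is weakly* lower
  semicontinuous.

  Conversely, if \<open>ess sup g(\<nabla>u) < c\<close> and \<open>A\<close> is an interior point of \<open>{f \<le> c}\<close>, then
  \<open>(1 - t) \<nabla>u + t A\<close> lies in \<open>{f \<le> c}\<close> a.e. for \<open>0 < t \<le> 1\<close>, and it is the gradient of
  \<open>(1 - t) u + t A x\<close>, which converges to \<open>u\<close> as \<open>t \<rightarrow> 0\<close>. Sequential lower semicontinuity gives the
  other inequality. That the chosen weak gradient of the perturbation is the expected one requires
  the fundamental lemma of the calculus of variations.
\<close>

section \<open>Smooth bump functions of boxes\<close>

lemma partial_derivative_eqI:
  "(\<phi> has_derivative D) (at x) \<Longrightarrow> partial_derivative j \<phi> x = D (axis j 1)"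
  unfolding partial_derivative_def by (metis frechet_derivative_at)

lemma times_continuously_differentiable_SucD:
  "times_continuously_differentiable (Suc k) \<phi> \<Longrightarrow> times_continuously_differentiable k \<phi>"
proof (induction k arbitrary: \<phi>)
  case 0
  then show ?case
    by (auto intro!: continuous_at_imp_continuous_on differentiable_imp_continuous_within)
next
  case (Suc k)
  then show ?case
    unfolding times_continuously_differentiable.simps(2)[of "Suc k" \<phi>]
      times_continuously_differentiable.simps(2)[of k \<phi>] by blast
qed

lemma times_continuously_differentiable_const:
  "times_continuously_differentiable k (\<lambda>x::real^'a::finite. c)"
proof (induction k arbitrary: c)
  case (Suc k)
  have "partial_derivative j (\<lambda>x::real^'a. c) = (\<lambda>x. 0)" for j
    by (rule ext, subst partial_derivative_eqI[where D = "\<lambda>_. 0"]) auto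
  then show ?case using Suc[of 0] by simp
qed simp

lemma times_continuously_differentiable_add:
  assumes "times_continuously_differentiable k \<phi>" "times_continuously_differentiable k \<psi>"
  shows "times_continuously_differentiable k (\<lambda>x. \<phi> x + \<psi> x)"
  using assms
proof (induction k arbitrary: \<phi> \<psi>)
  case 0
  then show ?case by (auto intro: continuous_intros)
next
  case (Suc k)
  then have d: "\<And>x. \<phi> differentiable at x" "\<And>x. \<psi> differentiable at x" by auto
  have "partial_derivative j (\<lambda>x. \<phi> x + \<psi> x) =
      (\<lambda>x. partial_derivative j \<phi> x + partial_derivative j \<psi> x)" for j
    by (rule ext, rule trans, rule partial_derivative_eqI, rule has_derivative_add)
      (use d in \<open>auto simp: partial_derivative_def frechet_derivative_works\<close>)
  then show ?case using Suc d by auto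
qed

lemma times_continuously_differentiable_mult:
  assumes "times_continuously_differentiable k \<phi>" "times_continuously_differentiable k \<psi>"
  shows "times_continuously_differentiable k (\<lambda>x. \<phi> x * \<psi> x)"
  using assms
proof (induction k arbitrary: \<phi> \<psi>)
  case 0
  then show ?case by (auto intro: continuous_intros)
next
  case (Suc k)
  then have d: "\<And>x. \<phi> differentiable at x" "\<And>x. \<psi> differentiable at x" by auto
  have "partial_derivative j (\<lambda>x. \<phi> x * \<psi> x) =
      (\<lambda>x. \<phi> x * partial_derivative j \<psi> x + partial_derivative j \<phi> x * \<psi> x)" for j
    by (rule ext, rule trans, rule partial_derivative_eqI, rule has_derivative_mult)
      (use d in \<open>auto simp: partial_derivative_def frechet_derivative_works\<close>)
  \<comment> \<open>The Leibniz rule keeps one factor of each term undifferentiated, so the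
    induction hypothesis also needs the regularity of order \<open>k\<close> of
    \<open>\<phi>\<close> and \<open>\<psi>\<close> themselves.\<close>
  moreover have "times_continuously_differentiable k \<phi>" "times_continuously_differentiable k \<psi>"
    using Suc.prems times_continuously_differentiable_SucD by blast+
  ultimately show ?case using Suc d by (auto intro!: times_continuously_differentiable_add)
qed

lemma times_continuously_differentiable_prod:
  assumes "\<And>i. i \<in> I \<Longrightarrow> times_continuously_differentiable k (\<phi> i)"
  shows "times_continuously_differentiable k (\<lambda>x. \<Prod>i\<in>I. \<phi> i x)"
  using assms
  by (induction I rule: infinite_finite_induct)
    (auto intro: times_continuously_differentiable_const times_continuously_differentiable_mult)

text \<open>The polynomial factor makes the family closed under differentiation.\<close>

definition flat_exp :: "real poly \<Rightarrow> real \<Rightarrow> real" where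
  "flat_exp p t = (if 0 < t then poly p (inverse t) * exp (- inverse t) else 0)"

text \<open>From the right, the substitution s = 1/t turns this into the decay of p(s) exp(-s) at
  infinity; from the left the function is identically 0.\<close>

lemma flat_exp_tendsto_0: "(flat_exp p \<longlongrightarrow> 0) (at 0)"
  unfolding filterlim_at_split
proof
  have "((\<lambda>s. poly p s * exp (- s)) \<longlongrightarrow> 0) at_top"
  proof -
    have "((\<lambda>s. \<Sum>i\<le>degree p. coeff p i * (s ^ i / exp s)) \<longlongrightarrow> (\<Sum>i\<le>degree p. coeff p i * 0)) at_top"
      by (intro tendsto_intros tendsto_power_div_exp_0)
    then show ?thesis
      by (simp add: poly_altdef exp_minus field_simps sum_distrib_right sum_divide_distrib)
  qed
  from filterlim_compose[OF this filterlim_inverse_at_top_right]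
  have "((\<lambda>t. poly p (inverse t) * exp (- inverse t)) \<longlongrightarrow> 0) (at_right 0)" .
  then show "(flat_exp p \<longlongrightarrow> 0) (at_right 0)"
    by (rule Lim_transform_eventually)
      (auto simp: eventually_at_filter flat_exp_def)
  show "(flat_exp p \<longlongrightarrow> 0) (at_left 0)"
    by (rule Lim_transform_eventually[OF tendsto_const])
      (auto simp: eventually_at_filter flat_exp_def)
qed

text \<open>For t > 0 put s = 1/t: the chain rule gives s^2 (p(s) - p'(s)) exp(-s), which is where
  the polynomial \<open>monom 1 2 * (p - pderiv p)\<close> comes from. Only t = 0 requires a
  limit.\<close>

lemma flat_exp_has_real_derivative:
  "(flat_exp p has_real_derivative flat_exp (monom 1 2 * (p - pderiv p)) t) (at t)"
proof -
  consider "t > 0" | "t < 0" | "t = 0" by linarith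
  then show ?thesis
  proof cases
    case 1
    then have "((\<lambda>t. poly p (inverse t) * exp (- inverse t)) has_real_derivative
        flat_exp (monom 1 2 * (p - pderiv p)) t) (at t)"
      by (auto intro!: derivative_eq_intros simp: flat_exp_def poly_monom power2_eq_square algebra_simps)
    then show ?thesis
      by (rule has_field_derivative_transform_within_open[where S = "{0<..}"])
        (use 1 in \<open>auto simp: flat_exp_def\<close>)
  next
    case 2
    then have "((\<lambda>t. 0) has_real_derivative flat_exp (monom 1 2 * (p - pderiv p)) t) (at t)"
      by (simp add: flat_exp_def)
    then show ?thesis
      by (rule has_field_derivative_transform_within_open[where S = "{..<0}"])
        (use 2 in \<open>auto simp: flat_exp_def\<close>)
  next
    case 3
    \<comment> \<open>Dividing by h multiplies the polynomial in 1/h by its variable, so the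
      difference quotient at 0 is again in the family and the previous limit applies.\<close>
    have "(\<lambda>h. (flat_exp p h - flat_exp p 0) / h) = flat_exp (pCons 0 p)"
      by (auto simp: flat_exp_def fun_eq_iff field_simps)
    then show ?thesis
      using 3 flat_exp_tendsto_0[of "pCons 0 p"]
      by (simp add: DERIV_def flat_exp_def[of _ 0])
  qed
qed

text \<open>Every partial derivative is a constant times a function of the same form with another
  polynomial; hence the induction on \<open>k\<close> with \<open>p\<close> arbitrary.\<close>

lemma times_continuously_differentiable_flat_exp:
  "times_continuously_differentiable k (\<lambda>x. flat_exp p (c \<bullet> x + b))"
proof (induction k arbitrary: p)
  have d: "((\<lambda>x. flat_exp p (c \<bullet> x + b)) has_derivative
      (\<lambda>h. (c \<bullet> h) * flat_exp (monom 1 2 * (p - pderiv p)) (c \<bullet> x + b))) (at x)" for p x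
    by (rule DERIV_compose_FDERIV[OF flat_exp_has_real_derivative]) (auto intro!: derivative_eq_intros)
  {
    case 0
    show ?case
      using d by (auto intro!: continuous_at_imp_continuous_on has_derivative_continuous)
  next
    case (Suc k)
    have "partial_derivative j (\<lambda>x. flat_exp p (c \<bullet> x + b)) =
      (\<lambda>x. (c $ j) * flat_exp (monom 1 2 * (p - pderiv p)) (c \<bullet> x + b))" for j
      by (rule ext, subst partial_derivative_eqI[OF d]) (simp add: inner_axis)
    then show ?case
      using d Suc by (auto simp: differentiable_def
        intro!: times_continuously_differentiable_mult times_continuously_differentiable_const)
  }
qed

text \<open>Each face of the box contributes one factor exp(-1/t), where t is \<open>Suc m\<close>
  times the signed distance to that face. The dilation lets every factor tend to 1 inside the box as
  \<open>m\<close> grows, while the product stays 0 outside.\<close>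

definition box_bump :: "real^'n \<Rightarrow> real^'n \<Rightarrow> nat \<Rightarrow> real^'n::finite \<Rightarrow> real" where
  "box_bump a b m x = (\<Prod>i\<in>UNIV. flat_exp 1 (real (Suc m) * (x $ i - a $ i)) *
     flat_exp 1 (real (Suc m) * (b $ i - x $ i)))"

lemma flat_exp_1_bounds: "0 \<le> flat_exp 1 t" "flat_exp 1 t \<le> 1"
  by (auto simp: flat_exp_def)

lemma box_bump_eq_0: "x \<notin> box a b \<Longrightarrow> box_bump a b m x = 0"
  by (force simp: box_bump_def mem_box_cart flat_exp_def zero_less_mult_iff)

lemma box_bump_bounds: "0 \<le> box_bump a b m x" "box_bump a b m x \<le> 1"
  unfolding box_bump_def
  by (auto intro!: prod_nonneg prod_le_1 mult_le_one mult_nonneg_nonneg simp: flat_exp_1_bounds)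

text \<open>Each factor is \<open>flat_exp 1\<close> of an affine function. The support is only
  known to lie in the closed box, hence the assumption on \<open>cbox a b\<close>.\<close>

lemma box_bump_test_function:
  assumes "cbox a b \<subseteq> \<Omega>"
  shows "box_bump a b m \<in> test_functions \<Omega>"
proof -
  have "times_continuously_differentiable k (\<lambda>x. \<Prod>i\<in>UNIV.
      flat_exp 1 (axis i (real (Suc m)) \<bullet> x + - real (Suc m) * a $ i) *
      flat_exp 1 (axis i (- real (Suc m)) \<bullet> x + real (Suc m) * b $ i))" for k
    by (intro times_continuously_differentiable_prod times_continuously_differentiable_mult
        times_continuously_differentiable_flat_exp)
  then have "times_continuously_differentiable k (box_bump a b m)" for k
    by (simp add: box_bump_def[abs_def] inner_axis' algebra_simps)
  moreover have "closure {x. box_bump a b m x \<noteq> 0} \<subseteq> cbox a b"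
    using box_bump_eq_0[of _ a b m] box_subset_cbox[of a b] by (intro closure_minimal) auto
  ultimately show ?thesis
    using assms compact_cbox unfolding test_functions_def
    by (auto simp: compact_eq_bounded_closed intro: bounded_subset[OF bounded_cbox])
qed

lemma box_bump_tendsto: "(\<lambda>m. box_bump a b m x) \<longlonglongrightarrow> indicator (box a b) x"
proof (cases "x \<in> box a b")
  case True
  have *: "(\<lambda>m. flat_exp 1 (real (Suc m) * s)) \<longlonglongrightarrow> 1" if "s > 0" for s
  proof -
    have "(\<lambda>m. exp (- (inverse (real (Suc m)) * inverse s))) \<longlonglongrightarrow> exp (- (0 * inverse s))"
      by (intro tendsto_intros LIMSEQ_inverse_real_of_nat)
    then show ?thesis using that by (simp add: flat_exp_def zero_less_mult_iff)
  qed
  have "(\<lambda>m. box_bump a b m x) \<longlonglongrightarrow> (\<Prod>i\<in>(UNIV :: 'a set). 1 * 1)"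
    unfolding box_bump_def using True
    by (intro tendsto_prod tendsto_mult *) (auto simp: mem_box_cart)
  then show ?thesis using True by simp
qed (simp add: box_bump_eq_0)

section \<open>The fundamental lemma of the calculus of variations\<close>

text \<open>Since \<open>ennreal\<close> truncates negative values to 0, the two sides are the
  integrals of the positive and negative parts. Both are finite, and the integral of
  \<open>f\<close> is their difference.\<close>

lemma nn_integral_pos_eq_neg:
  fixes f :: "'a \<Rightarrow> real"
  assumes "integrable M f"
  shows "(\<integral>\<^sup>+x. ennreal (f x) \<partial>M) = (\<integral>\<^sup>+x. ennreal (- f x) \<partial>M) \<longleftrightarrow> integral\<^sup>L M f = 0"
proof -
  have "(\<integral>\<^sup>+x. ennreal (f x) \<partial>M) < \<infinity>" "(\<integral>\<^sup>+x. ennreal (- f x) \<partial>M) < \<infinity>"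
    using assms by (auto simp: real_integrable_def less_top)
  then have "(\<integral>\<^sup>+x. ennreal (f x) \<partial>M) = (\<integral>\<^sup>+x. ennreal (- f x) \<partial>M) \<longleftrightarrow>
      enn2real (\<integral>\<^sup>+x. ennreal (f x) \<partial>M) = enn2real (\<integral>\<^sup>+x. ennreal (- f x) \<partial>M)"
    by (metis ennreal_enn2real infinity_ennreal_def)
  then show ?thesis
    by (simp add: real_lebesgue_integral_def[OF assms])
qed

text \<open>Boxes are an intersection-stable generator of the Borel sets. The measures whose
  densities are the positive and negative parts of \<open>v\<close> agree on boxes, hence on all
  Borel sets, so every Borel set integral of \<open>v\<close> vanishes.\<close>

lemma AE_eq_0_if_box_integrals_eq_0:
  fixes v :: "'a::euclidean_space \<Rightarrow> real"
  assumes v: "integrable lborel v" and 0: "\<And>a b. (LINT x:box a b|lborel. v x) = 0"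
  shows "AE x in lborel. v x = 0"
proof -
  note [measurable] = borel_measurable_integrable[OF v]
  let ?D = "\<lambda>f. density lborel (\<lambda>x. ennreal (f x))"
  have D: "emeasure (?D f) A = (\<integral>\<^sup>+x. ennreal (indicator A x *\<^sub>R f x) \<partial>lborel)"
    if [measurable]: "A \<in> sets borel" "f \<in> borel_measurable borel" for A and f :: "'a \<Rightarrow> real"
    by (auto simp: emeasure_density intro!: nn_integral_cong split: split_indicator)
  have eq: "emeasure (?D v) A = emeasure (?D (\<lambda>x. - v x)) A \<longleftrightarrow> (LINT x:A|lborel. v x) = 0"
    if A: "A \<in> sets borel" for A
    using nn_integral_pos_eq_neg[of lborel "\<lambda>x. indicator A x *\<^sub>R v x"]
      integrable_mult_indicator[OF _ v, of A] A
    by (simp add: D set_lebesgue_integral_def)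
  have "?D v = ?D (\<lambda>x. - v x)"
  proof (rule measure_eqI_generator_eq)
    show "Int_stable (range (\<lambda>(a, b). box a b :: 'a set))"
      by (auto simp: Int_stable_def box_Int_box)
    show "emeasure (?D v) X = emeasure (?D (\<lambda>x. - v x)) X" if "X \<in> range (\<lambda>(a, b). box a b)" for X
      using that 0 eq by auto
    show "sets (?D v) = sigma_sets UNIV (range (\<lambda>(a, b). box a b))"
      "sets (?D (\<lambda>x. - v x)) = sigma_sets UNIV (range (\<lambda>(a, b). box a b))"
      by (simp_all add: borel_eq_box)
    \<comment> \<open>The uniqueness theorem for measures asks for an exhaustion by generators of
      finite measure; centred cubes provide it.\<close>
    let ?A = "\<lambda>n::nat. box (- (real n *\<^sub>R One)) (real n *\<^sub>R One) :: 'a set"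
    show "range ?A \<subseteq> range (\<lambda>(a, b). box a b)" "(\<Union>i. ?A i) = UNIV"
      unfolding UN_box_eq_UNIV by auto
    show "emeasure (?D v) (?A i) \<noteq> \<infinity>" for i
      using integrable_mult_indicator[OF _ v, of "?A i"] by (simp add: D real_integrable_def)
  qed auto
  then have "(LINT x:A|lborel. v x) = (LINT x:A|lborel. 0)" if "A \<in> sets lborel" for A
    using eq[of A] that by (simp add: set_lebesgue_integral_def)
  from density_unique_real[OF v _ this] show ?thesis by simp
qed

text \<open>This moves the integration by parts for linear maps to the whole space, where
  translation invariance is available.\<close>

lemma integral_lebesgue_on_eq_lborel:
  fixes h :: "'a::euclidean_space \<Rightarrow> real"
  assumes "\<Omega> \<in> sets lebesgue" "h \<in> borel_measurable borel" "\<And>x. x \<notin> \<Omega> \<Longrightarrow> h x = 0"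
  shows "(LINT x|lebesgue_on \<Omega>. h x) = (LINT x|lborel. h x)"
proof -
  have "(LINT x|lebesgue_on \<Omega>. h x) = (LINT x|lebesgue. indicator \<Omega> x *\<^sub>R h x)"
    using assms by (subst integral_restrict_space) auto
  also have "(\<lambda>x. indicator \<Omega> x *\<^sub>R h x) = h"
    using assms(3) by (auto simp: fun_eq_iff split: split_indicator)
  finally show ?thesis using assms by (simp add: integral_completion)
qed

lemma test_function_borel_measurable:
  assumes "\<phi> \<in> test_functions \<Omega>"
  shows "\<phi> \<in> borel_measurable borel"
proof -
  have "times_continuously_differentiable 0 \<phi>"
    using assms unfolding test_functions_def by blast
  then show ?thesis by (simp add: borel_measurable_continuous_onI)
qed

text \<open>Bumps approximate the indicator of any box whose closed box lies in \<Omega>, so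
  \<open>w\<close> has integral 0 over every such box and vanishes a.e. there; countably many of
  these boxes cover \<Omega>.\<close>

lemma fundamental_lemma_calculus_of_variations:
  fixes w :: "real^'n::finite \<Rightarrow> real"
  assumes \<Omega>: "open \<Omega>" and w: "integrable (lebesgue_on \<Omega>) w"
    and 0: "\<And>\<phi>. \<phi> \<in> test_functions \<Omega> \<Longrightarrow> (LINT x|lebesgue_on \<Omega>. w x * \<phi> x) = 0"
  shows "AE x in lebesgue_on \<Omega>. w x = 0"
proof -
  have \<Omega>': "\<Omega> \<in> sets lebesgue" using \<Omega> by auto
  have W: "integrable lebesgue (\<lambda>x. indicator \<Omega> x * w x)"
    using w \<Omega>' by (simp add: integrable_restrict_space)
  \<comment> \<open>The extension of \<open>w\<close> by zero is only Lebesgue measurable. A Borel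
    function \<open>v\<close> equal to it a.e. allows working with \<open>lborel\<close>.\<close>
  from completion_ex_borel_measurable_real[OF borel_measurable_integrable[OF this]]
  obtain v where v[measurable]: "v \<in> borel_measurable borel"
    and wv: "AE x in lborel. indicator \<Omega> x * w x = v x" by auto
  have wv': "AE x in lebesgue. indicator \<Omega> x * w x = v x"
    using wv by (rule AE_completion)
  have "integrable lebesgue v \<longleftrightarrow> integrable lebesgue (\<lambda>x. indicator \<Omega> x * w x)"
    by (rule integrable_cong_AE)
      (use wv' borel_measurable_integrable[OF W] in \<open>auto intro: measurable_completion\<close>)
  then have v_int: "integrable lborel v"
    using W by (simp add: integrable_completion)
  have bump: "(LINT x|lborel. box_bump a b m x * v x) = 0" if ab: "cbox a b \<subseteq> \<Omega>" for a b m
  proof -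
    have \<phi>: "box_bump a b m \<in> test_functions \<Omega>" by (rule box_bump_test_function[OF ab])
    note [measurable] = test_function_borel_measurable[OF \<phi>]
    have "(LINT x|lborel. box_bump a b m x * v x) = (LINT x|lebesgue. box_bump a b m x * v x)"
      by (simp add: integral_completion)
    also have "\<dots> = (LINT x|lebesgue. indicator \<Omega> x *\<^sub>R (w x * box_bump a b m x))"
    proof (rule integral_cong_AE)
      have "(\<lambda>x. indicator \<Omega> x * w x * box_bump a b m x) \<in> borel_measurable lebesgue"
        by (intro borel_measurable_times borel_measurable_integrable[OF W] measurable_completion) simp
      then show "(\<lambda>x. indicator \<Omega> x *\<^sub>R (w x * box_bump a b m x)) \<in> borel_measurable lebesgue"
        by (simp add: mult.assoc)
      show "AE x in lebesgue. box_bump a b m x * v x = indicator \<Omega> x *\<^sub>R (w x * box_bump a b m x)"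
        using wv' by eventually_elim simp
    qed (auto intro: measurable_completion)
    also have "\<dots> = (LINT x|lebesgue_on \<Omega>. w x * box_bump a b m x)"
      using \<Omega>' by (subst integral_restrict_space) auto
    finally show ?thesis using 0[OF \<phi>] by simp
  qed
  have box0: "(LINT x:box a b|lborel. v x) = 0" if ab: "cbox a b \<subseteq> \<Omega>" for a b
  proof -
    \<comment> \<open>Bumps have values in [0, 1], so |v| dominates and the limit passes under the
      integral.\<close>
    have "(\<lambda>m. LINT x|lborel. box_bump a b m x * v x) \<longlonglongrightarrow> (LINT x|lborel. indicator (box a b) x * v x)"
    proof (rule integral_dominated_convergence)
      show "integrable lborel (\<lambda>x. norm (v x))" using v_int by simp
      show "AE x in lborel. (\<lambda>m. box_bump a b m x * v x) \<longlonglongrightarrow> indicator (box a b) x * v x"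
        by (intro AE_I2 tendsto_mult box_bump_tendsto tendsto_const)
      show "AE x in lborel. norm (box_bump a b m x * v x) \<le> norm (v x)" for m
        using box_bump_bounds[of a b m] by (auto simp: abs_mult intro!: mult_left_le_one_le)
      show "(\<lambda>x. box_bump a b m x * v x) \<in> borel_measurable lborel" for m
        using test_function_borel_measurable[OF box_bump_test_function[OF ab]] by simp
    qed simp
    then show ?thesis
      using bump[OF ab] by (simp add: set_lebesgue_integral_def LIMSEQ_const_iff)
  qed
  have AE_box: "AE x in lborel. x \<in> box a b \<longrightarrow> v x = 0" if ab: "cbox a b \<subseteq> \<Omega>" for a b
  proof -
    have "AE x in lborel. indicator (box a b) x *\<^sub>R v x = 0"
    proof (rule AE_eq_0_if_box_integrals_eq_0)
      show "integrable lborel (\<lambda>x. indicator (box a b) x *\<^sub>R v x)"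
        using v_int by (intro integrable_mult_indicator) auto
      fix c d
      \<comment> \<open>These are the corners of the intersection of the two boxes. The integral of
        the localised function over any box is thus an integral of \<open>v\<close> over a box
        already known to give 0.\<close>
      define a' b' where "a' = (\<Sum>i\<in>Basis. max (c\<bullet>i) (a\<bullet>i) *\<^sub>R i)"
        and "b' = (\<Sum>i\<in>Basis. min (d\<bullet>i) (b\<bullet>i) *\<^sub>R i)"
      have "cbox a' b' \<subseteq> cbox a b"
        by (auto simp: a'_def b'_def mem_box)
      then have "(LINT x:box a' b'|lborel. v x) = 0"
        using ab by (intro box0) auto
      then show "(LINT x:box c d|lborel. indicator (box a b) x *\<^sub>R v x) = 0"
        by (simp add: set_lebesgue_integral_def a'_def b'_def indicator_inter_arith mult.assoc
            flip: box_Int_box)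
    qed
    then show ?thesis by eventually_elim auto
  qed
  let ?\<F> = "{box a b | a b. cbox a b \<subseteq> \<Omega>}"
  \<comment> \<open>Only countably many exceptional null sets may be united, so the cover by boxes
    is thinned out by the Lindelof property.\<close>
  obtain \<F>' where \<F>': "\<F>' \<subseteq> ?\<F>" "countable \<F>'" "\<Union>\<F>' = \<Union>?\<F>"
    using Lindelof[of ?\<F>] open_box by blast
  have "x \<in> \<Union>?\<F>" if x: "x \<in> \<Omega>" for x
  proof -
    obtain a b where "x \<in> box a b" "cbox a b \<subseteq> \<Omega>"
      using \<Omega> x open_contains_cbox by metis
    then show ?thesis by blast
  qed
  moreover have "AE x in lborel. \<forall>B\<in>\<F>'. x \<in> B \<longrightarrow> v x = 0"
    using \<F>' AE_box by (subst AE_ball_countable) auto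
  ultimately have "AE x in lborel. x \<in> \<Omega> \<longrightarrow> v x = 0"
    using \<F>'(3) by (auto elim!: eventually_mono)
  with wv have "AE x in lborel. x \<in> \<Omega> \<longrightarrow> w x = 0"
    by eventually_elim auto
  then show ?thesis
    using \<Omega>' by (simp add: AE_restrict_space_iff AE_completion)
qed

section \<open>Weak gradients of linear maps\<close>

lemma partial_derivative_has_real_derivative:
  assumes "\<And>x. \<psi> differentiable at x"
  shows "((\<lambda>s. \<psi> (x + s *\<^sub>R axis j 1)) has_real_derivative
    partial_derivative j \<psi> (x + s *\<^sub>R axis j 1)) (at s)"
proof -
  let ?D = "frechet_derivative \<psi> (at (x + s *\<^sub>R axis j 1))"
  have D: "(\<psi> has_derivative ?D) (at (x + s *\<^sub>R axis j 1))"
    using assms frechet_derivative_works by blast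
  have "((\<lambda>s. \<psi> (x + s *\<^sub>R axis j 1)) has_derivative (\<lambda>h. ?D (h *\<^sub>R axis j 1))) (at s)"
    by (rule has_derivative_compose[where g = \<psi> and g' = ?D]) (use D in \<open>auto intro!: derivative_eq_intros\<close>)
  moreover have "?D (h *\<^sub>R axis j 1) = partial_derivative j \<psi> (x + s *\<^sub>R axis j 1) * h" for h
    using linear_scale[OF has_derivative_linear[OF D]]
    by (simp add: partial_derivative_def)
  ultimately show ?thesis by (simp add: has_field_derivative_def)
qed

lemma partial_derivative_eq_0:
  assumes "x \<notin> closure {x. \<psi> x \<noteq> 0}"
  shows "partial_derivative j \<psi> x = 0"
proof -
  have "(\<psi> has_derivative (\<lambda>_. 0)) (at x)"
    by (rule has_derivative_transform_within_open[of "\<lambda>_. 0" _ _ _ "- closure {x. \<psi> x \<noteq> 0}"])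
      (use assms closure_subset[of "{x. \<psi> x \<noteq> 0}"] in auto)
  then show ?thesis by (simp add: partial_derivative_eqI)
qed

lemma integrable_continuous_compact_support:
  fixes h :: "'a::euclidean_space \<Rightarrow> real"
  assumes "continuous_on UNIV h" "compact K" "\<And>x. x \<notin> K \<Longrightarrow> h x = 0"
  shows "integrable lborel h"
proof -
  have "integrable lborel (\<lambda>x. indicator K x *\<^sub>R h x)"
    using assms by (intro borel_integrable_compact) (auto intro: continuous_on_subset)
  moreover have "(\<lambda>x. indicator K x *\<^sub>R h x) = h"
    using assms(3) by (auto simp: fun_eq_iff split: split_indicator)
  ultimately show ?thesis by simp
qed

text \<open>Translation invariance makes every difference quotient integrate to zero.\<close>

lemma integral_partial_derivative_eq_0:
  fixes \<psi> :: "real^'n::finite \<Rightarrow> real"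
  assumes \<psi>: "times_continuously_differentiable (Suc 0) \<psi>"
    and K: "compact (closure {x. \<psi> x \<noteq> 0})" (is "compact ?K")
  shows "(LINT x|lborel. partial_derivative j \<psi> x) = 0"
proof -
  let ?e = "axis j 1 :: real^'n" and ?D = "partial_derivative j \<psi>"
  define q where "q n x = (\<psi> (x + inverse (real (Suc n)) *\<^sub>R ?e) - \<psi> x) / inverse (real (Suc n))" for n x
  have diff: "\<And>x. \<psi> differentiable at x" and D_cont: "continuous_on UNIV ?D"
    using \<psi> by auto
  have \<psi>_cont: "continuous_on UNIV \<psi>"
    using diff by (auto intro!: continuous_at_imp_continuous_on differentiable_imp_continuous_within)
  have [measurable]: "\<psi> \<in> borel_measurable borel" "?D \<in> borel_measurable borel"
    using \<psi>_cont D_cont by (auto intro: borel_measurable_continuous_onI)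
  have \<psi>0: "\<psi> x = 0" if "x \<notin> ?K" for x
    using that closure_subset[of "{x. \<psi> x \<noteq> 0}"] by auto
  have "bounded (?D ` ?K)"
    using K D_cont by (intro compact_imp_bounded compact_continuous_image)
      (auto intro: continuous_on_subset)
  then obtain B where B: "B > 0" "\<And>x. x \<in> ?K \<Longrightarrow> \<bar>?D x\<bar> \<le> B"
    unfolding bounded_pos by auto
  \<comment> \<open>The bound on the support is global because the derivative vanishes off the
    support.\<close>
  have DB: "\<bar>?D x\<bar> \<le> B" for x
    using B partial_derivative_eq_0[of x \<psi> j] by (cases "x \<in> ?K") auto
  have \<psi>_int: "integrable lborel \<psi>"
    using integrable_continuous_compact_support[OF \<psi>_cont K \<psi>0] .
  have q0: "(LINT x|lborel. q n x) = 0" for n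
  proof -
    let ?c = "inverse (real (Suc n)) *\<^sub>R ?e"
    have "integrable (distr lborel borel ((+) ?c)) \<psi>"
      using \<psi>_int by (simp add: lborel_distr_plus)
    then have "integrable lborel (\<lambda>x. \<psi> (?c + x))"
      by (subst (asm) integrable_distr_eq) auto
    moreover have "(LINT x|lborel. \<psi> (?c + x)) = (LINT x|distr lborel borel ((+) ?c). \<psi> x)"
      by (subst integral_distr) auto
    ultimately show ?thesis
      unfolding q_def using \<psi>_int by (simp add: lborel_distr_plus add.commute)
  qed
  \<comment> \<open>The increments 1/(n+1) are at most 1, so the closed unit neighbourhood of the
    support contains the supports of all difference quotients. The constant \<open>B\<close> on it
    is an integrable dominating function.\<close>
  define K' where "K' = {x + y | x y. x \<in> ?K \<and> y \<in> cball 0 1}"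
  have K': "compact K'"
    unfolding K'_def by (intro compact_sums K compact_cball)
  have "(\<lambda>n. LINT x|lborel. q n x) \<longlonglongrightarrow> (LINT x|lborel. ?D x)"
  proof (rule integral_dominated_convergence)
    show "integrable lborel (\<lambda>x. indicator K' x *\<^sub>R B)"
      using K' by (intro borel_integrable_compact) auto
    show "AE x in lborel. (\<lambda>n. q n x) \<longlonglongrightarrow> ?D x"
    proof (rule AE_I2)
      fix x
      have "(\<lambda>h. (\<psi> (x + h *\<^sub>R ?e) - \<psi> x) / h) \<midarrow>0\<rightarrow> ?D x"
        using partial_derivative_has_real_derivative[OF diff, of x j 0] by (simp add: DERIV_def)
      moreover have "filterlim (\<lambda>n. inverse (real (Suc n))) (at 0) sequentially"
        using LIMSEQ_inverse_real_of_nat by (simp add: filterlim_at)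
      ultimately show "(\<lambda>n. q n x) \<longlonglongrightarrow> ?D x"
        unfolding q_def by (rule filterlim_compose)
    qed
    show "AE x in lborel. norm (q n x) \<le> indicator K' x *\<^sub>R B" for n
    proof (rule AE_I2)
      fix x
      let ?h = "inverse (real (Suc n))"
      have h: "0 < ?h" "?h \<le> 1" by (auto simp: field_simps)
      show "norm (q n x) \<le> indicator K' x *\<^sub>R B"
      proof (cases "x \<in> K'")
        case True
        \<comment> \<open>By the mean value theorem the difference quotient is a value of the
          partial derivative, so it inherits the bound \<open>B\<close>.\<close>
        obtain z where "\<psi> (x + ?h *\<^sub>R ?e) - \<psi> (x + 0 *\<^sub>R ?e) = (?h - 0) * ?D (x + z *\<^sub>R ?e)"
          using MVT2[OF h(1), of "\<lambda>s. \<psi> (x + s *\<^sub>R ?e)" "\<lambda>s. ?D (x + s *\<^sub>R ?e)"]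
            partial_derivative_has_real_derivative[OF diff] by blast
        then have "q n x = ?D (x + z *\<^sub>R ?e)"
          using h unfolding q_def by (simp del: of_nat_Suc)
        then show ?thesis using DB True by simp
      next
        case False
        have "x \<notin> ?K"
        proof
          assume "x \<in> ?K"
          then have "x + 0 \<in> K'" unfolding K'_def by force
          with False show False by simp
        qed
        moreover have "x + ?h *\<^sub>R ?e \<notin> ?K"
        proof
          assume "x + ?h *\<^sub>R ?e \<in> ?K"
          moreover have "- (?h *\<^sub>R ?e) \<in> cball 0 1"
            using h by (simp add: dist_norm norm_axis_1 del: of_nat_Suc)
          ultimately have "(x + ?h *\<^sub>R ?e) + - (?h *\<^sub>R ?e) \<in> K'" unfolding K'_def by blast
          with False show False by simp
        qed
        ultimately have "\<psi> x = 0" "\<psi> (x + ?h *\<^sub>R ?e) = 0" by (blast intro: \<psi>0)+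
        then show ?thesis by (simp only: q_def) (simp add: B(1) less_imp_le)
      qed
    qed
    show "q n \<in> borel_measurable lborel" for n unfolding q_def by measurable
  qed simp
  then show ?thesis by (simp add: q0 LIMSEQ_const_iff)
qed

lemma partial_derivative_linear_mult:
  assumes "\<And>x. \<phi> differentiable at x"
  shows "partial_derivative j (\<lambda>x. (c \<bullet> x) * \<phi> x) x =
    (c \<bullet> x) * partial_derivative j \<phi> x + c $ j * \<phi> x"
proof -
  have "((\<lambda>x. (c \<bullet> x) * \<phi> x) has_derivative
      (\<lambda>h. (c \<bullet> x) * frechet_derivative \<phi> (at x) h + (c \<bullet> h) * \<phi> x)) (at x)"
    using assms frechet_derivative_works
    by (intro has_derivative_mult) (auto intro!: derivative_eq_intros)
  from partial_derivative_eqI[OF this, of j] show ?thesis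
    by (simp add: inner_axis partial_derivative_def)
qed

text \<open>The product of row \<open>i\<close> of the linear map with \<phi> is C^1 with compact
  support, so its partial derivative integrates to 0. The Leibniz rule splits that derivative into
  the two integrands of the claim.\<close>

lemma is_weak_gradient_linear:
  fixes A :: "real^'n::finite^'d::finite"
  assumes \<Omega>: "open \<Omega>"
  shows "is_weak_gradient \<Omega> (\<lambda>x. A *v x) (\<lambda>_. A)"
  unfolding is_weak_gradient_def
proof (intro ballI allI)
  fix \<phi> i j assume \<phi>: "\<phi> \<in> test_functions \<Omega>"
  define K where "K = closure {x. \<phi> x \<noteq> 0}"
  let ?D = "partial_derivative j \<phi>" and ?\<psi> = "\<lambda>x. (A $ i \<bullet> x) * \<phi> x"
  have K: "compact K" "K \<subseteq> \<Omega>" and tcd: "\<And>k. times_continuously_differentiable k \<phi>"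
    using \<phi> by (auto simp: test_functions_def K_def)
  have "times_continuously_differentiable (Suc 0) \<phi>" by (rule tcd)
  then have diff: "\<And>x. \<phi> differentiable at x" and
    cD: "\<And>j. continuous_on UNIV (partial_derivative j \<phi>)" by auto
  have c: "continuous_on UNIV \<phi>" using tcd[of 0] by simp
  have D\<psi>: "partial_derivative l ?\<psi> = (\<lambda>x. (A $ i \<bullet> x) * partial_derivative l \<phi> x + A $ i $ l * \<phi> x)" for l
    using partial_derivative_linear_mult[OF diff] by blast
  have 0: "\<phi> x = 0" "?D x = 0" if "x \<notin> K" for x
    using that closure_subset[of "{x. \<phi> x \<noteq> 0}"] partial_derivative_eq_0[of x \<phi>] by (auto simp: K_def)
  have "times_continuously_differentiable (Suc 0) ?\<psi>"
    unfolding times_continuously_differentiable.simps D\<psi>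
    using diff cD c by (auto intro!: continuous_intros derivative_intros)
  moreover have "closure {x. ?\<psi> x \<noteq> 0} \<subseteq> K"
    unfolding K_def by (intro closure_mono) auto
  then have "compact (closure {x. ?\<psi> x \<noteq> 0})"
    using compact_Int_closed[OF K(1) closed_closure, of "{x. ?\<psi> x \<noteq> 0}"] by (simp only: Int_absorb1)
  ultimately have "(LINT x|lborel. partial_derivative j ?\<psi> x) = 0"
    by (rule integral_partial_derivative_eq_0)
  moreover have c1: "continuous_on UNIV (\<lambda>x. (A $ i \<bullet> x) * ?D x)"
    and c2: "continuous_on UNIV (\<lambda>x. A $ i $ j * \<phi> x)"
    by (intro continuous_intros c cD)+
  have "integrable lborel (\<lambda>x. (A $ i \<bullet> x) * ?D x)" "integrable lborel (\<lambda>x. A $ i $ j * \<phi> x)"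
    by (rule integrable_continuous_compact_support[OF c1 K(1)], simp add: 0)
      (rule integrable_continuous_compact_support[OF c2 K(1)], simp add: 0)
  then have "(LINT x|lborel. partial_derivative j ?\<psi> x) =
      (LINT x|lborel. (A $ i \<bullet> x) * ?D x) + (LINT x|lborel. A $ i $ j * \<phi> x)"
    unfolding D\<psi> by (rule Bochner_Integration.integral_add)
  moreover have "(LINT x|lebesgue_on \<Omega>. (A *v x) $ i * ?D x) = (LINT x|lborel. (A $ i \<bullet> x) * ?D x)"
    unfolding matrix_vector_mul_component
    by (rule integral_lebesgue_on_eq_lborel[OF _ borel_measurable_continuous_onI[OF c1]])
      (use \<Omega> 0 K in auto)
  moreover have "(LINT x|lebesgue_on \<Omega>. A $ i $ j * \<phi> x) = (LINT x|lborel. A $ i $ j * \<phi> x)"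
    by (rule integral_lebesgue_on_eq_lborel[OF _ borel_measurable_continuous_onI[OF c2]])
      (use \<Omega> 0 K in auto)
  ultimately show "(LINT x|lebesgue_on \<Omega>. (A *v x) $ i * ?D x) =
      - (LINT x|lebesgue_on \<Omega>. A $ i $ j * \<phi> x)" by linarith
qed

section \<open>Convergence in \<open>W\<^bsup>1,\<infinity>\<^esup>\<close>\<close>

lemma Linfty_linear_combination:
  assumes "g \<in> Linfty \<Omega>" "h \<in> Linfty \<Omega>"
  shows "(\<lambda>x. a *\<^sub>R g x + b *\<^sub>R h x) \<in> Linfty \<Omega>"
proof -
  obtain C D where *: "AE x in lebesgue_on \<Omega>. norm (g x) \<le> C" "AE x in lebesgue_on \<Omega>. norm (h x) \<le> D"
    and [measurable]: "g \<in> borel_measurable (lebesgue_on \<Omega>)" "h \<in> borel_measurable (lebesgue_on \<Omega>)"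
    using assms by (auto simp: Linfty_def)
  from * have "AE x in lebesgue_on \<Omega>. norm (a *\<^sub>R g x + b *\<^sub>R h x) \<le> \<bar>a\<bar> * C + \<bar>b\<bar> * D"
    by eventually_elim (auto intro!: norm_triangle_le add_mono mult_left_mono)
  then show ?thesis unfolding Linfty_def by auto
qed

lemma integrable_Linfty_inner:
  assumes "g \<in> Linfty \<Omega>" "integrable (lebesgue_on \<Omega>) \<phi>"
  shows "integrable (lebesgue_on \<Omega>) (\<lambda>x. g x \<bullet> \<phi> x)"
proof -
  obtain C where C: "AE x in lebesgue_on \<Omega>. norm (g x) \<le> C"
    and [measurable]: "g \<in> borel_measurable (lebesgue_on \<Omega>)"
    using assms by (auto simp: Linfty_def)
  note [measurable] = borel_measurable_integrable[OF assms(2)]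
  have "integrable (lebesgue_on \<Omega>) (\<lambda>x. C * norm (\<phi> x))"
    using assms(2) by auto
  then show ?thesis
  proof (rule Bochner_Integration.integrable_bound)
    show "AE x in lebesgue_on \<Omega>. norm (g x \<bullet> \<phi> x) \<le> norm (C * norm (\<phi> x))"
      using C
    proof eventually_elim
      case (elim x)
      have "norm (g x \<bullet> \<phi> x) \<le> norm (g x) * norm (\<phi> x)"
        using Cauchy_Schwarz_ineq2[of "g x" "\<phi> x"] by simp
      also have "\<dots> \<le> C * norm (\<phi> x)" using elim by (intro mult_right_mono) auto
      finally show ?case by (simp add: order_trans[OF _ abs_ge_self])
    qed
  qed measurable
qed

lemma Linfty_component:
  fixes g :: "'a::euclidean_space \<Rightarrow> ('b::euclidean_space)^'d::finite"
  assumes "g \<in> Linfty \<Omega>"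
  shows "(\<lambda>x. g x $ i) \<in> Linfty \<Omega>"
proof -
  have [measurable]: "g \<in> borel_measurable (lebesgue_on \<Omega>)" using assms by (simp add: Linfty_def)
  have "continuous_on UNIV (\<lambda>y :: 'b^'d. y $ i)" by (intro continuous_intros)
  then have "(\<lambda>y :: 'b^'d. y $ i) \<in> borel_measurable borel" by (rule borel_measurable_continuous_onI)
  then have "(\<lambda>x. g x $ i) \<in> borel_measurable (lebesgue_on \<Omega>)" by measurable
  moreover obtain C where "AE x in lebesgue_on \<Omega>. norm (g x) \<le> C"
    using assms by (auto simp: Linfty_def)
  then have "AE x in lebesgue_on \<Omega>. norm (g x $ i) \<le> C"
    by eventually_elim (rule order_trans[OF Finite_Cartesian_Product.norm_nth_le])
  ultimately show ?thesis unfolding Linfty_def by auto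
qed

text \<open>The closure of a bounded set is compact, so continuous functions are bounded on it. This
  puts linear maps into \<open>Linfty\<close>.\<close>

lemma Linfty_continuous:
  fixes g :: "'a::euclidean_space \<Rightarrow> 'b::euclidean_space"
  assumes "continuous_on UNIV g" "bounded \<Omega>"
  shows "g \<in> Linfty \<Omega>"
proof -
  have "g \<in> borel_measurable lebesgue"
    using assms(1) by (simp add: borel_measurable_continuous_onI measurable_completion)
  moreover have "bounded (g ` closure \<Omega>)"
    using assms by (intro compact_imp_bounded compact_continuous_image)
      (auto intro: continuous_on_subset simp: compact_closure)
  then obtain C where "\<And>x. x \<in> closure \<Omega> \<Longrightarrow> norm (g x) \<le> C"
    unfolding bounded_iff by auto
  then have "AE x in lebesgue_on \<Omega>. norm (g x) \<le> C"
    using closure_subset by (intro AE_I2) auto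
  ultimately show ?thesis unfolding Linfty_def by (auto intro: measurable_restrict_space1)
qed

lemma integrable_lebesgue_on_lborel:
  fixes h :: "'a::euclidean_space \<Rightarrow> real"
  assumes "integrable lborel h" "\<Omega> \<in> sets lebesgue"
  shows "integrable (lebesgue_on \<Omega>) h"
proof -
  have "integrable lebesgue h"
    using assms(1) borel_measurable_integrable[OF assms(1)] by (simp add: integrable_completion)
  then show ?thesis
    using assms(2) integrable_mult_indicator[OF assms(2), of h] by (simp add: integrable_restrict_space)
qed

lemma test_function_integrable:
  assumes \<Omega>: "open \<Omega>" and \<phi>: "\<phi> \<in> test_functions \<Omega>"
  shows "integrable (lebesgue_on \<Omega>) \<phi>" "integrable (lebesgue_on \<Omega>) (partial_derivative j \<phi>)"
proof -
  define K where "K = closure {x. \<phi> x \<noteq> 0}"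
  have K: "compact K" and tcd: "\<And>k. times_continuously_differentiable k \<phi>"
    using \<phi> by (auto simp: test_functions_def K_def)
  have 0: "\<phi> x = 0" "partial_derivative j \<phi> x = 0" if "x \<notin> K" for x
    using that closure_subset[of "{x. \<phi> x \<noteq> 0}"] partial_derivative_eq_0[of x \<phi>] by (auto simp: K_def)
  have "continuous_on UNIV \<phi>" "continuous_on UNIV (partial_derivative j \<phi>)"
    using tcd[of 0] tcd[of "Suc 0"] by auto
  then have "integrable lborel \<phi>" "integrable lborel (partial_derivative j \<phi>)"
    using K 0 by (blast intro: integrable_continuous_compact_support)+
  then show "integrable (lebesgue_on \<Omega>) \<phi>" "integrable (lebesgue_on \<Omega>) (partial_derivative j \<phi>)"
    using \<Omega> by (auto intro: integrable_lebesgue_on_lborel)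
qed

lemma integrable_Linfty_mult:
  fixes g :: "'a::euclidean_space \<Rightarrow> real"
  assumes "g \<in> Linfty \<Omega>" "integrable (lebesgue_on \<Omega>) \<phi>"
  shows "integrable (lebesgue_on \<Omega>) (\<lambda>x. g x * \<phi> x)"
  using integrable_Linfty_inner[OF assms] by simp

text \<open>Splitting the integrals requires every term to be integrable; the memberships in
  \<open>Linfty\<close> and the integrability of test functions and their derivatives ensure
  this.\<close>

lemma is_weak_gradient_linear_combination:
  assumes \<Omega>: "open \<Omega>"
    and L: "u \<in> Linfty \<Omega>" "v \<in> Linfty \<Omega>" "Du \<in> Linfty \<Omega>" "Dv \<in> Linfty \<Omega>"
    and u: "is_weak_gradient \<Omega> u Du" and v: "is_weak_gradient \<Omega> v Dv"
  shows "is_weak_gradient \<Omega> (\<lambda>x. a *\<^sub>R u x + b *\<^sub>R v x) (\<lambda>x. a *\<^sub>R Du x + b *\<^sub>R Dv x)"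
  unfolding is_weak_gradient_def
proof (intro ballI allI)
  fix \<phi> i j assume \<phi>: "\<phi> \<in> test_functions \<Omega>"
  note int = test_function_integrable[OF \<Omega> \<phi>]
  have *: "(LINT x|lebesgue_on \<Omega>. (a * p x + b * q x) * r x) =
      a * (LINT x|lebesgue_on \<Omega>. p x * r x) + b * (LINT x|lebesgue_on \<Omega>. q x * r x)"
    if "p \<in> Linfty \<Omega>" "q \<in> Linfty \<Omega>" "integrable (lebesgue_on \<Omega>) r" for p q r
    using integrable_Linfty_mult[OF that(1,3)] integrable_Linfty_mult[OF that(2,3)]
    by (simp add: distrib_right mult.assoc)
  show "(LINT x|lebesgue_on \<Omega>. (a *\<^sub>R u x + b *\<^sub>R v x) $ i * partial_derivative j \<phi> x) =
      - (LINT x|lebesgue_on \<Omega>. (a *\<^sub>R Du x + b *\<^sub>R Dv x) $ i $ j * \<phi> x)"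
    using u v \<phi> L int
    by (simp add: * Linfty_component is_weak_gradient_def)
qed

section \<open>Uniqueness of weak gradients\<close>

text \<open>Each entry of the difference integrates to 0 against all test functions, so the
  fundamental lemma applies to each of the finitely many entries.\<close>

lemma weak_gradient_unique_AE:
  assumes \<Omega>: "open \<Omega>" "bounded \<Omega>"
    and L: "Du \<in> Linfty \<Omega>" "Dv \<in> Linfty \<Omega>"
    and u: "is_weak_gradient \<Omega> u Du" "is_weak_gradient \<Omega> u Dv"
  shows "AE x in lebesgue_on \<Omega>. Du x = Dv x"
proof -
  \<comment> \<open>On a bounded set constants are integrable; multiplying by 1 then turns
    membership in \<open>Linfty\<close> into integrability.\<close>
  have 1: "integrable (lebesgue_on \<Omega>) (\<lambda>x. 1 :: real)"
    using finite_measure.integrable_const[OF finite_measure_lebesgue_on[OF lmeasurable_open[OF \<Omega>(2,1)]]] .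
  have "AE x in lebesgue_on \<Omega>. Du x $ i $ j - Dv x $ i $ j = 0" for i j
  proof (rule fundamental_lemma_calculus_of_variations[OF \<Omega>(1)])
    have D: "(\<lambda>x. Du x $ i $ j) \<in> Linfty \<Omega>" "(\<lambda>x. Dv x $ i $ j) \<in> Linfty \<Omega>"
      using L by (auto intro: Linfty_component)
    show "integrable (lebesgue_on \<Omega>) (\<lambda>x. Du x $ i $ j - Dv x $ i $ j)"
      using integrable_Linfty_mult[OF D(1) 1] integrable_Linfty_mult[OF D(2) 1] by simp
    fix \<phi> assume \<phi>: "\<phi> \<in> test_functions \<Omega>"
    note int = test_function_integrable(1)[OF \<Omega>(1) \<phi>]
    have "(LINT x|lebesgue_on \<Omega>. Du x $ i $ j * \<phi> x) = (LINT x|lebesgue_on \<Omega>. Dv x $ i $ j * \<phi> x)"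
      using u(1)[unfolded is_weak_gradient_def, rule_format, OF \<phi>, of i j]
        u(2)[unfolded is_weak_gradient_def, rule_format, OF \<phi>, of i j] by linarith
    then show "(LINT x|lebesgue_on \<Omega>. (Du x $ i $ j - Dv x $ i $ j) * \<phi> x) = 0"
      using integrable_Linfty_mult[OF D(1) int] integrable_Linfty_mult[OF D(2) int]
      by (simp add: left_diff_distrib)
  qed
  then have "AE x in lebesgue_on \<Omega>. \<forall>i j. Du x $ i $ j - Dv x $ i $ j = 0"
    by (simp add: AE_all_countable)
  then show ?thesis by eventually_elim (simp add: vec_eq_iff)
qed

text \<open>The representative \<open>weak_gradient \<Omega> v\<close> is an arbitrary choice, so
  linearity of the gradient can be claimed only a.e.; uniqueness transfers it from the explicit
  candidate.\<close>

lemma W1infty_add_linear: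
  fixes u :: "real^'n::finite \<Rightarrow> real^'d::finite"
    and A :: "real^'n^'d" and a b :: real
  assumes \<Omega>: "open \<Omega>" "bounded \<Omega>" and u: "u \<in> W1infty \<Omega>"
  defines "v \<equiv> (\<lambda>x. a *\<^sub>R u x + b *\<^sub>R (A *v x))"
  shows "v \<in> W1infty \<Omega>" "AE x in lebesgue_on \<Omega>. weak_gradient \<Omega> v x = a *\<^sub>R weak_gradient \<Omega> u x + b *\<^sub>R A"
proof -
  have L: "u \<in> Linfty \<Omega>" "(\<lambda>x. A *v x) \<in> Linfty \<Omega>" "(\<lambda>x. A) \<in> Linfty \<Omega>"
    using u \<Omega>(2) by (auto simp: W1infty_def intro!: Linfty_continuous continuous_intros)
  let ?D = "\<lambda>x. a *\<^sub>R weak_gradient \<Omega> u x + b *\<^sub>R A"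
  have D: "is_weak_gradient \<Omega> v ?D"
    unfolding v_def using L weak_gradient[OF u] is_weak_gradient_linear[OF \<Omega>(1)]
    by (intro is_weak_gradient_linear_combination[OF \<Omega>(1)]) auto
  have D_L: "?D \<in> Linfty \<Omega>"
    using L(3) weak_gradient(1)[OF u] by (intro Linfty_linear_combination)
  have "v \<in> Linfty \<Omega>" unfolding v_def using L by (intro Linfty_linear_combination)
  then show v: "v \<in> W1infty \<Omega>" using D D_L by (auto simp: W1infty_def)
  show "AE x in lebesgue_on \<Omega>. weak_gradient \<Omega> v x = ?D x"
    by (rule weak_gradient_unique_AE[OF \<Omega> weak_gradient(1)[OF v] D_L weak_gradient(2)[OF v] D])
qed

section \<open>Criteria for weak* convergence\<close>

text \<open>Convergence is needed only on the generating sets: being eventually in a set passes to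
  finite intersections and arbitrary unions, by induction over the generated topology.\<close>

lemma limitin_Linfty_weak_starI:
  assumes l: "l \<in> Linfty \<Omega>" and g: "\<And>n. g n \<in> Linfty \<Omega>"
    and lim: "\<And>\<phi>. integrable (lebesgue_on \<Omega>) \<phi> \<Longrightarrow>
      ((\<lambda>n. LINT x|lebesgue_on \<Omega>. g n x \<bullet> \<phi> x) \<longlongrightarrow> (LINT x|lebesgue_on \<Omega>. l x \<bullet> \<phi> x)) F"
  shows "limitin (Linfty_weak_star \<Omega>) g l F"
  unfolding limitin_def
proof (intro conjI allI impI)
  show "l \<in> topspace (Linfty_weak_star \<Omega>)" using l by simp
  fix U assume U: "openin (Linfty_weak_star \<Omega>) U \<and> l \<in> U"
  then have "generate_topology_on {{g \<in> Linfty \<Omega>. (LINT x|lebesgue_on \<Omega>. g x \<bullet> \<phi> x) \<in> V} | \<phi> V.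
        integrable (lebesgue_on \<Omega>) \<phi> \<and> open V} U"
    unfolding Linfty_weak_star_def by (simp add: openin_topology_generated_by_iff)
  moreover have "l \<in> U" using U by simp
  ultimately show "\<forall>\<^sub>F n in F. g n \<in> U"
  proof induction
    case (Int a b)
    then show ?case by (auto intro: eventually_conj)
  next
    case (UN K)
    then obtain k where k: "k \<in> K" "l \<in> k" by blast
    with UN have "\<forall>\<^sub>F n in F. g n \<in> k" by blast
    then show ?case by eventually_elim (use k in blast)
  next
    case (Basis s)
    then obtain \<phi> V where s: "s = {g \<in> Linfty \<Omega>. (LINT x|lebesgue_on \<Omega>. g x \<bullet> \<phi> x) \<in> V}"
      and \<phi>: "integrable (lebesgue_on \<Omega>) \<phi>" and V: "open V" by blast
    have "\<forall>\<^sub>F n in F. (LINT x|lebesgue_on \<Omega>. g n x \<bullet> \<phi> x) \<in> V"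
      using Basis s V lim[OF \<phi>] by (auto dest: topological_tendstoD)
    then show ?case unfolding s using g by auto
  qed simp
qed

lemma limitin_W1infty_weak_starI:
  assumes "u \<in> W1infty \<Omega>" "\<And>n. v n \<in> W1infty \<Omega>"
    and "limitin (Linfty_weak_star \<Omega>) v u F"
    and "limitin (Linfty_weak_star \<Omega>) (\<lambda>n. weak_gradient \<Omega> (v n)) (weak_gradient \<Omega> u) F"
  shows "limitin (W1infty_weak_star \<Omega>) v u F"
proof -
  have lim: "limitin (prod_topology (Linfty_weak_star \<Omega>) (Linfty_weak_star \<Omega>))
      (\<lambda>n. (v n, weak_gradient \<Omega> (v n))) (u, weak_gradient \<Omega> u) F"
    using assms(3,4) by (simp add: limitin_pairwise o_def)
  show ?thesis
    unfolding limitin_def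
  proof (intro conjI allI impI)
    show "u \<in> topspace (W1infty_weak_star \<Omega>)" using assms(1) by simp
    fix U assume "openin (W1infty_weak_star \<Omega>) U \<and> u \<in> U"
    then obtain W where W: "openin (prod_topology (Linfty_weak_star \<Omega>) (Linfty_weak_star \<Omega>)) W"
      "U = (\<lambda>u. (u, weak_gradient \<Omega> u)) -` W \<inter> W1infty \<Omega>" "(u, weak_gradient \<Omega> u) \<in> W"
      unfolding W1infty_weak_star_def openin_pullback_topology by blast
    then have "\<forall>\<^sub>F n in F. (v n, weak_gradient \<Omega> (v n)) \<in> W"
      using lim by (auto simp: limitin_def)
    then show "\<forall>\<^sub>F n in F. v n \<in> U"
      by eventually_elim (use W assms(2) in auto)
  qed
qed

text \<open>Paired with a fixed integrable function, both the combination and its gradient depend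
  affinely on \<open>t n\<close>, so the pairings converge as \<open>t n\<close> tends to 0.\<close>

lemma limitin_convex_combination_linear:
  fixes u :: "real^'n::finite \<Rightarrow> real^'d::finite"
  assumes \<Omega>: "open \<Omega>" "bounded \<Omega>" and u: "u \<in> W1infty \<Omega>" and t: "(t \<longlongrightarrow> 0) F"
  shows "limitin (W1infty_weak_star \<Omega>) (\<lambda>n x. (1 - t n) *\<^sub>R u x + t n *\<^sub>R (A *v x)) u F"
proof -
  let ?v = "\<lambda>n x. (1 - t n) *\<^sub>R u x + t n *\<^sub>R (A *v x)"
  have L: "u \<in> Linfty \<Omega>" "(\<lambda>x. A *v x) \<in> Linfty \<Omega>" "(\<lambda>x. A) \<in> Linfty \<Omega>"
    using u \<Omega>(2) by (auto simp: W1infty_def intro!: Linfty_continuous continuous_intros)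
  have v: "?v n \<in> W1infty \<Omega>" for n by (rule W1infty_add_linear[OF \<Omega> u])
  \<comment> \<open>The target type of \<phi> is left general so that this limit serves both the
    functions and their gradients.\<close>
  have lim: "((\<lambda>n. LINT x|lebesgue_on \<Omega>. ((1 - t n) *\<^sub>R p x + t n *\<^sub>R q x) \<bullet> \<phi> x) \<longlongrightarrow>
      (LINT x|lebesgue_on \<Omega>. p x \<bullet> \<phi> x)) F"
    if p: "p \<in> Linfty \<Omega>" and q: "q \<in> Linfty \<Omega>" and \<phi>: "integrable (lebesgue_on \<Omega>) \<phi>"
    for p q and \<phi> :: "real^'n \<Rightarrow> 'b::euclidean_space"
  proof -
    have "(LINT x|lebesgue_on \<Omega>. ((1 - t n) *\<^sub>R p x + t n *\<^sub>R q x) \<bullet> \<phi> x) =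
        (1 - t n) * (LINT x|lebesgue_on \<Omega>. p x \<bullet> \<phi> x) + t n * (LINT x|lebesgue_on \<Omega>. q x \<bullet> \<phi> x)" for n
      using integrable_Linfty_inner[OF p \<phi>] integrable_Linfty_inner[OF q \<phi>]
      by (simp add: inner_add_left)
    moreover have "((\<lambda>n. (1 - t n) * (LINT x|lebesgue_on \<Omega>. p x \<bullet> \<phi> x) +
        t n * (LINT x|lebesgue_on \<Omega>. q x \<bullet> \<phi> x)) \<longlongrightarrow>
        (1 - 0) * (LINT x|lebesgue_on \<Omega>. p x \<bullet> \<phi> x) + 0 * (LINT x|lebesgue_on \<Omega>. q x \<bullet> \<phi> x)) F"
      by (intro tendsto_intros t)
    ultimately show ?thesis by simp
  qed
  show ?thesis
  proof (rule limitin_W1infty_weak_starI[OF u v])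
    show "limitin (Linfty_weak_star \<Omega>) ?v u F"
      using L by (intro limitin_Linfty_weak_starI lim Linfty_linear_combination)
    show "limitin (Linfty_weak_star \<Omega>) (\<lambda>n. weak_gradient \<Omega> (?v n)) (weak_gradient \<Omega> u) F"
    proof (rule limitin_Linfty_weak_starI)
      fix \<phi> :: "real^'n \<Rightarrow> real^'n^'d" assume \<phi>: "integrable (lebesgue_on \<Omega>) \<phi>"
      note [measurable] = borel_measurable_integrable[OF \<phi>]
      have [measurable]: "weak_gradient \<Omega> u \<in> borel_measurable (lebesgue_on \<Omega>)"
        "\<And>n. weak_gradient \<Omega> (?v n) \<in> borel_measurable (lebesgue_on \<Omega>)"
        using weak_gradient(1)[OF u] weak_gradient(1)[OF v] by (auto simp: Linfty_def)
      have "(LINT x|lebesgue_on \<Omega>. weak_gradient \<Omega> (?v n) x \<bullet> \<phi> x) =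
          (LINT x|lebesgue_on \<Omega>. ((1 - t n) *\<^sub>R weak_gradient \<Omega> u x + t n *\<^sub>R A) \<bullet> \<phi> x)" for n
      proof (rule integral_cong_AE)
        show "AE x in lebesgue_on \<Omega>. weak_gradient \<Omega> (?v n) x \<bullet> \<phi> x =
            ((1 - t n) *\<^sub>R weak_gradient \<Omega> u x + t n *\<^sub>R A) \<bullet> \<phi> x"
          using W1infty_add_linear(2)[OF \<Omega> u, of "1 - t n" "t n" A] by eventually_elim simp
      qed measurable
      then show "((\<lambda>n. LINT x|lebesgue_on \<Omega>. weak_gradient \<Omega> (?v n) x \<bullet> \<phi> x) \<longlongrightarrow>
          (LINT x|lebesgue_on \<Omega>. weak_gradient \<Omega> u x \<bullet> \<phi> x)) F"
        using lim[OF weak_gradient(1)[OF u] L(3) \<phi>] by simp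
    qed (use weak_gradient(1)[OF u] weak_gradient(1)[OF v] in auto)
  qed
qed

section \<open>Lower semicontinuous envelopes of supremal functionals\<close>

text \<open>A superlevel set of a supremum is the union of the superlevel sets of its
  members.\<close>

lemma lower_semicontinuous_map_lsc_envelope: "lower_semicontinuous_map T (lsc_envelope T F)"
  unfolding lower_semicontinuous_map_def
proof
  fix a
  have "{x \<in> topspace T. a < lsc_envelope T F x} =
    (\<Union>G \<in> {G. lower_semicontinuous_map T G \<and> (\<forall>y \<in> topspace T. G y \<le> F y)}. {x \<in> topspace T. a < G x})"
    by (auto simp: lsc_envelope_def less_SUP_iff)
  then show "openin T {x \<in> topspace T. a < lsc_envelope T F x}"
    by (auto simp: lower_semicontinuous_map_def)
qed

lemma lsc_envelope_le: "x \<in> topspace T \<Longrightarrow> lsc_envelope T F x \<le> F x"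
  by (auto simp: lsc_envelope_def intro: SUP_least)

lemma lsc_envelope_greatest:
  assumes "lower_semicontinuous_map T G" "\<And>y. y \<in> topspace T \<Longrightarrow> G y \<le> F y"
  shows "G x \<le> lsc_envelope T F x"
  unfolding lsc_envelope_def using assms by (intro SUP_upper) auto

text \<open>The sequential topology is finer, so it admits more competitors in the supremum.\<close>

lemma lsc_envelope_sequential_topology:
  "lsc_envelope T F x \<le> lsc_envelope (sequential_topology T) F x"
  unfolding lsc_envelope_def
  by (intro SUP_subset_mono) (auto intro: lower_semicontinuous_map_sequential_topology)

section \<open>Sublevel sets of the envelope\<close>

text \<open>A point outside the closure of {f \<le> c} has envelope at least c, by an explicit
  competitor. Conversely {envelope \<le> c} is closed and contains {f \<le> c}. For a = \<infinity>
  the index set is empty and both sides are the whole space.\<close>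

lemma sublevel_lsc_envelope:
  fixes f :: "'a::euclidean_space \<Rightarrow> ereal" and a :: ereal
  shows "{\<xi>. lsc_envelope euclidean f \<xi> \<le> a} = (\<Inter>c\<in>{c::real. a < ereal c}. closure {\<xi>. f \<xi> \<le> ereal c})"
proof (intro equalityI subsetI InterI)
  fix \<xi> B assume \<xi>: "\<xi> \<in> {\<xi>. lsc_envelope euclidean f \<xi> \<le> a}"
    and "B \<in> (\<lambda>c. closure {\<xi>. f \<xi> \<le> ereal c}) ` {c. a < ereal c}"
  then obtain c where c: "a < ereal c" and B: "B = closure {\<xi>. f \<xi> \<le> ereal c}" by auto
  show "\<xi> \<in> B"
  proof (rule ccontr)
    assume "\<xi> \<notin> B"
    \<comment> \<open>This two-valued function is lower semicontinuous because \<open>B\<close> is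
      closed, and it lies below \<open>f\<close> because \<open>f\<close> exceeds \<open>c\<close>
      off \<open>B\<close>.\<close>
    define G where "G y = (if y \<in> B then - \<infinity> else ereal c)" for y
    have "open (- B)" unfolding B by (rule open_Compl) simp
    moreover have "{x. b < G x} = (if b < ereal c then - B else {})" for b
      by (auto simp: G_def)
    ultimately have "lower_semicontinuous_map euclidean G"
      by (simp add: lower_semicontinuous_map_def)
    moreover have "G y \<le> f y" for y
    proof (cases "y \<in> B")
      case False
      then have "\<not> f y \<le> ereal c"
        using closure_subset[of "{\<xi>. f \<xi> \<le> ereal c}"] unfolding B by blast
      with False show ?thesis using linear[of "f y" "ereal c"] by (simp add: G_def)
    qed (simp add: G_def)
    ultimately have "G \<xi> \<le> lsc_envelope euclidean f \<xi>" by (intro lsc_envelope_greatest)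
    then show False using \<open>\<xi> \<notin> B\<close> \<xi> c by (auto simp: G_def)
  qed
next
  fix \<xi> assume \<xi>: "\<xi> \<in> (\<Inter>c\<in>{c::real. a < ereal c}. closure {\<xi>. f \<xi> \<le> ereal c})"
  have "lsc_envelope euclidean f \<xi> \<le> c" if "a < ereal c" for c
  proof -
    have "open {\<xi>. ereal c < lsc_envelope euclidean f \<xi>}"
      using lower_semicontinuous_map_lsc_envelope[of euclidean f]
      by (simp add: lower_semicontinuous_map_def)
    then have "closed {\<xi>. lsc_envelope euclidean f \<xi> \<le> ereal c}"
      by (simp add: closed_def Collect_neg_eq[symmetric] not_le)
    moreover have "{\<xi>. f \<xi> \<le> c} \<subseteq> {\<xi>. lsc_envelope euclidean f \<xi> \<le> ereal c}"
      using lsc_envelope_le[of _ euclidean f] by (auto intro: order_trans)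
    ultimately have "closure {\<xi>. f \<xi> \<le> c} \<subseteq> {\<xi>. lsc_envelope euclidean f \<xi> \<le> ereal c}"
      by (rule closure_minimal[rotated])
    then show ?thesis using \<xi> that by auto
  qed
  then show "\<xi> \<in> {\<xi>. lsc_envelope euclidean f \<xi> \<le> a}"
    using ereal_dense2 by (metis mem_Collect_eq not_le)
qed

text \<open>For a \<ge> inf f every c > a is covered by the convexity assumption, and closures and
  intersections preserve convexity. For a < inf f a level c strictly between has an empty sublevel
  set of \<open>f\<close>, so that of the envelope is empty too.\<close>

lemma convex_sublevel_lsc_envelope:
  fixes f :: "'a::euclidean_space \<Rightarrow> ereal"
  assumes convex: "\<And>c::real. (INF \<xi>. f \<xi>) < ereal c \<Longrightarrow> convex {\<xi>. f \<xi> \<le> ereal c}"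
  shows "convex {\<xi>. lsc_envelope euclidean f \<xi> \<le> a}"
proof (cases "a < (INF \<xi>. f \<xi>)")
  case True
  then obtain c where c: "a < ereal c" "ereal c < (INF \<xi>. f \<xi>)" using ereal_dense2 by blast
  then have "{\<xi>. f \<xi> \<le> ereal c} = {}" by (auto simp: less_INF_D not_le)
  moreover have "{\<xi>. lsc_envelope euclidean f \<xi> \<le> a} \<subseteq> closure {\<xi>. f \<xi> \<le> ereal c}"
    unfolding sublevel_lsc_envelope using c(1) by blast
  ultimately have "{\<xi>. lsc_envelope euclidean f \<xi> \<le> a} = {}" by simp
  then show ?thesis by (simp only: convex_empty)
next
  case False
  then show ?thesis
    unfolding sublevel_lsc_envelope by (intro convex_INT convex_closure convex) auto
qed

section \<open>The lower bound: weak* lower semicontinuity of the relaxed functional\<close>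

text \<open>By separation, the complement of \<open>K\<close> is a union of open half-spaces
  disjoint from \<open>K\<close>. Lindelof leaves countably many, so their null preimages can be
  united.\<close>

lemma closed_convex_AE_halfspaces:
  fixes K :: "'a::euclidean_space set"
  assumes K: "closed K" "convex K"
    and half: "\<And>c b. (\<And>y. y \<in> K \<Longrightarrow> c \<bullet> y \<le> b) \<Longrightarrow> AE x in M. c \<bullet> h x \<le> b"
  shows "AE x in M. h x \<in> K"
proof -
  let ?\<F> = "{{y. b < c \<bullet> y} | b c. \<forall>y\<in>K. c \<bullet> y \<le> b}"
  obtain \<F>' where \<F>': "\<F>' \<subseteq> ?\<F>" "countable \<F>'" "\<Union>\<F>' = \<Union>?\<F>"
    using Lindelof[of ?\<F>] open_halfspace_gt by blast
  have "y \<in> \<Union>?\<F>" if y: "y \<notin> K" for y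
  proof -
    obtain c b where "c \<bullet> y < b" "\<forall>x\<in>K. b < c \<bullet> x"
      using separating_hyperplane_closed_point[OF K(2,1) y] by blast
    then have "y \<in> {y. - b < (- c) \<bullet> y}" "\<forall>x\<in>K. (- c) \<bullet> x \<le> - b" by auto
    then show ?thesis by blast
  qed
  then have "- K \<subseteq> \<Union>\<F>'" unfolding \<F>'(3) by blast
  moreover have "AE x in M. \<forall>S\<in>\<F>'. h x \<notin> S"
    unfolding AE_ball_countable[OF \<F>'(2)]
  proof
    fix S assume "S \<in> \<F>'"
    then obtain b c where S: "S = {y. b < c \<bullet> y}" "\<forall>y\<in>K. c \<bullet> y \<le> b" using \<F>' by blast
    then have "AE x in M. c \<bullet> h x \<le> b" by (intro half) auto
    then show "AE x in M. h x \<notin> S" by eventually_elim (simp add: S)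
  qed
  ultimately show ?thesis
    by (elim eventually_mono) blast
qed

lemma openin_W1infty_weak_star_gradient_integral:
  fixes \<phi> :: "real^'n::finite \<Rightarrow> real^'n^'d::finite"
  assumes "integrable (lebesgue_on \<Omega>) \<phi>" "open V"
  shows "openin (W1infty_weak_star \<Omega>) {u \<in> W1infty \<Omega>. (LINT x|lebesgue_on \<Omega>. weak_gradient \<Omega> u x \<bullet> \<phi> x) \<in> V}"
proof -
  let ?B = "{g \<in> Linfty \<Omega>. (LINT x|lebesgue_on \<Omega>. g x \<bullet> \<phi> x) \<in> V}"
  have "openin (Linfty_weak_star \<Omega>) ?B"
    unfolding Linfty_weak_star_def by (rule topology_generated_by_Basis) (use assms in blast)
  moreover have "openin (Linfty_weak_star \<Omega> :: (real^'n \<Rightarrow> real^'d) topology) (Linfty \<Omega>)"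
    using openin_topspace[of "Linfty_weak_star \<Omega> :: (real^'n \<Rightarrow> real^'d) topology"] by simp
  ultimately have "openin (prod_topology (Linfty_weak_star \<Omega>) (Linfty_weak_star \<Omega>))
      ((Linfty \<Omega> :: (real^'n \<Rightarrow> real^'d) set) \<times> ?B)"
    by (simp add: openin_prod_Times_iff)
  moreover have "{u \<in> W1infty \<Omega>. (LINT x|lebesgue_on \<Omega>. weak_gradient \<Omega> u x \<bullet> \<phi> x) \<in> V} =
      (\<lambda>u. (u, weak_gradient \<Omega> u)) -` (Linfty \<Omega> \<times> ?B) \<inter> W1infty \<Omega>"
    using weak_gradient(1) by (auto simp: W1infty_def)
  ultimately show ?thesis
    unfolding W1infty_weak_star_def openin_pullback_topology by blast
qed

text \<open>If the value at \<open>u\<close> exceeds \<open>a\<close>, the gradient violates on a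
  non-null set \<open>E\<close> some half-space constraint c . y \<le> b valid on {g \<le> a}. The
  integral over \<open>E\<close> of c . Dv - b is weakly* continuous in \<open>v\<close>, positive
  at \<open>u\<close>, and nonpositive when the value at \<open>v\<close> is at most
  \<open>a\<close>; its positivity defines the neighbourhood sought.\<close>

lemma lower_semicontinuous_map_esssup:
  fixes g :: "real^'n::finite^'d::finite \<Rightarrow> ereal" and \<Omega> :: "(real^'n) set"
  assumes \<Omega>: "open \<Omega>" "bounded \<Omega>"
    and g: "\<And>a. closed {\<xi>. g \<xi> \<le> a}" "\<And>a. convex {\<xi>. g \<xi> \<le> a}"
  shows "lower_semicontinuous_map (W1infty_weak_star \<Omega>)
    (\<lambda>u. esssup (lebesgue_on \<Omega>) (\<lambda>x. g (weak_gradient \<Omega> u x)))" (is "lower_semicontinuous_map _ ?G")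
  unfolding lower_semicontinuous_map_def
proof
  fix a
  let ?M = "lebesgue_on \<Omega>" and ?D = "weak_gradient \<Omega>"
  have fin: "finite_measure ?M"
    by (rule finite_measure_lebesgue_on[OF lmeasurable_open[OF \<Omega>(2,1)]])
  \<comment> \<open>\<open>esssup\<close> has the default value \<open>top\<close> on non-measurable
    functions, so measurability must be known before it can be bounded from above.\<close>
  have [measurable]: "g \<in> borel_measurable borel"
    by (rule borel_measurableI_le) (use g in auto)
  have D_meas: "?D v \<in> borel_measurable ?M" if "v \<in> W1infty \<Omega>" for v
    using weak_gradient(1)[OF that] by (simp add: Linfty_def)
  show "openin (W1infty_weak_star \<Omega>) {u \<in> topspace (W1infty_weak_star \<Omega>). a < ?G u}"
  proof (subst openin_subopen, clarsimp)
    fix u assume u: "u \<in> W1infty \<Omega>" and a: "a < ?G u"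
    note [measurable] = D_meas[OF u]
    have "\<not> (AE x in ?M. ?D u x \<in> {\<xi>. g \<xi> \<le> a})"
    proof
      assume "AE x in ?M. ?D u x \<in> {\<xi>. g \<xi> \<le> a}"
      then have "?G u \<le> a" by (intro esssup_I) auto
      with a show False by simp
    qed
    then obtain c b where cb: "\<And>y. g y \<le> a \<Longrightarrow> c \<bullet> y \<le> b" "\<not> (AE x in ?M. c \<bullet> ?D u x \<le> b)"
      using closed_convex_AE_halfspaces[OF g] by blast
    define E where "E = {x \<in> space ?M. b < c \<bullet> ?D u x}"
    have E[measurable]: "E \<in> sets ?M" unfolding E_def by measurable
    have ind: "integrable ?M (\<lambda>x. indicator E x :: real)"
      using fin E by (simp add: finite_measure.emeasure_finite less_top[symmetric])
    \<comment> \<open>Testing the gradient against this function integrates c . Dv over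
      \<open>E\<close>; subtracting b times the measure of \<open>E\<close> gives the integral in
      \<open>J\<close>.\<close>
    define \<phi> where "\<phi> x = indicator E x *\<^sub>R c" for x
    have \<phi>: "integrable ?M \<phi>" unfolding \<phi>_def using ind by simp
    have J: "(LINT x|?M. ?D v x \<bullet> \<phi> x) - b * measure ?M E = (LINT x|?M. indicator E x * (c \<bullet> ?D v x - b))"
      "integrable ?M (\<lambda>x. indicator E x * (c \<bullet> ?D v x - b))"
      if "v \<in> W1infty \<Omega>" for v
    proof -
      have 1: "integrable ?M (\<lambda>x. ?D v x \<bullet> \<phi> x)"
        by (rule integrable_Linfty_inner[OF weak_gradient(1)[OF that] \<phi>])
      have 2: "indicator E x * (c \<bullet> ?D v x - b) = ?D v x \<bullet> \<phi> x - b * indicator E x" for x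
        by (simp add: \<phi>_def algebra_simps inner_commute)
      have E': "E \<inter> \<Omega> = E" by (auto simp: E_def)
      show "integrable ?M (\<lambda>x. indicator E x * (c \<bullet> ?D v x - b))"
        unfolding 2 using 1 ind by simp
      show "(LINT x|?M. ?D v x \<bullet> \<phi> x) - b * measure ?M E = (LINT x|?M. indicator E x * (c \<bullet> ?D v x - b))"
        unfolding 2 using 1 ind by (simp add: E')
    qed
    let ?V = "{b * measure ?M E <..}"
    let ?U = "{v \<in> W1infty \<Omega>. (LINT x|?M. ?D v x \<bullet> \<phi> x) \<in> ?V}"
    have pos: "indicator E x * (c \<bullet> ?D u x - b) \<ge> 0" for x
      by (auto simp: E_def split: split_indicator)
    have "(LINT x|?M. indicator E x * (c \<bullet> ?D u x - b)) \<noteq> 0"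
    proof
      assume "(LINT x|?M. indicator E x * (c \<bullet> ?D u x - b)) = 0"
      then have "AE x in ?M. indicator E x * (c \<bullet> ?D u x - b) = 0"
        using integral_nonneg_eq_0_iff_AE[OF J(2)[OF u]] pos by simp
      then have "AE x in ?M. c \<bullet> ?D u x \<le> b"
        using AE_space by eventually_elim (auto simp: E_def indicator_def split: if_splits)
      with cb(2) show False by simp
    qed
    moreover have "0 \<le> (LINT x|?M. indicator E x * (c \<bullet> ?D u x - b))"
      by (rule integral_nonneg_AE) (simp add: pos)
    ultimately have "0 < (LINT x|?M. indicator E x * (c \<bullet> ?D u x - b))" by simp
    then have "u \<in> ?U" using J(1)[OF u] u by simp
    moreover have "openin (W1infty_weak_star \<Omega>) ?U"
      by (rule openin_W1infty_weak_star_gradient_integral[OF \<phi>]) simp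
    moreover have "a < ?G v" if v: "v \<in> ?U" for v
    proof (rule ccontr)
      have v': "v \<in> W1infty \<Omega>" using v by simp
      assume "\<not> a < ?G v"
      then have "AE x in ?M. g (?D v x) \<le> a"
        using esssup_AE[of "\<lambda>x. g (?D v x)" ?M] by (auto elim!: eventually_mono simp: not_less)
      then have "AE x in ?M. indicator E x * (c \<bullet> ?D v x - b) \<le> 0"
        by eventually_elim (use cb(1) in \<open>auto simp: mult_le_0_iff\<close>)
      then have "(LINT x|?M. indicator E x * (c \<bullet> ?D v x - b)) \<le> (LINT x|?M. 0)"
        by (intro integral_mono_AE J(2)[OF v']) auto
      then show False using v J(1)[OF v'] by simp
    qed
    ultimately show "\<exists>T. openin (W1infty_weak_star \<Omega>) T \<and> u \<in> T \<and> T \<subseteq> {u \<in> W1infty \<Omega>. a < ?G u}"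
      by (intro exI[of _ ?U]) auto
  qed
qed

section \<open>The upper bound: approximation by gradients moved towards an interior point\<close>

text \<open>If a real \<open>c\<close> lay strictly between the two sides, \<open>u\<close> would be
  the limit of perturbations in the sequentially closed set {H \<le> c}, and so lie in that
  set.\<close>

lemma lower_semicontinuous_le_esssup:
  fixes f :: "real^'n::finite^'d::finite \<Rightarrow> ereal"
  assumes \<Omega>: "open \<Omega>" "bounded \<Omega>" and [measurable]: "f \<in> borel_measurable borel"
    and sub: "\<And>c::real. (INF \<xi>. f \<xi>) < ereal c \<Longrightarrow>
           convex {\<xi>. f \<xi> \<le> ereal c} \<and> interior {\<xi>. f \<xi> \<le> ereal c} \<noteq> {}"
    and u: "u \<in> W1infty \<Omega>"
    and H: "lower_semicontinuous_map (sequential_topology (W1infty_weak_star \<Omega>)) H"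
    and HF: "\<And>v. v \<in> W1infty \<Omega> \<Longrightarrow> H v \<le> supremal_functional \<Omega> f v"
  shows "H u \<le> esssup (lebesgue_on \<Omega>) (\<lambda>x. lsc_envelope euclidean f (weak_gradient \<Omega> u x))"
    (is "_ \<le> ?G")
proof (rule ccontr)
  let ?M = "lebesgue_on \<Omega>" and ?D = "weak_gradient \<Omega>" and ?g = "lsc_envelope euclidean f"
  assume "\<not> H u \<le> ?G"
  then obtain c where c: "?G < ereal c" "ereal c < H u"
    using ereal_dense2 by (metis not_le)
  have H_le: "H v \<le> ereal c" if v: "v \<in> W1infty \<Omega>" "AE x in ?M. f (?D v x) \<le> c" for v
  proof -
    have "?D v \<in> borel_measurable ?M"
      using weak_gradient(1)[OF v(1)] by (simp add: Linfty_def)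
    then have "supremal_functional \<Omega> f v \<le> c"
      unfolding supremal_functional_def using v(2) by (intro esssup_I) measurable
    with HF[OF v(1)] show ?thesis by (rule order_trans)
  qed
  let ?C = "{\<xi>. f \<xi> \<le> ereal c}"
  have AE_g: "AE x in ?M. ?g (?D u x) \<le> ?G" by (rule esssup_AE)
  have g_closure: "\<xi> \<in> closure {\<xi>. f \<xi> \<le> ereal c'}" if "?g \<xi> \<le> ?G" "?G < ereal c'" for \<xi> c'
    using sublevel_lsc_envelope[of f ?G] that by blast
  \<comment> \<open>Without such a point \<open>AE_g\<close> would make every property hold a.e., as
    for empty \<Omega>, and \<open>H_le\<close> would apply to \<open>u\<close> itself.\<close>
  have "\<exists>x. ?g (?D u x) \<le> ?G"
  proof (rule ccontr)
    assume "\<nexists>x. ?g (?D u x) \<le> ?G"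
    with AE_g have "AE x in ?M. f (?D u x) \<le> c" by (auto elim!: eventually_mono)
    then show False using H_le[OF u] c by simp
  qed
  then obtain x where x: "?g (?D u x) \<le> ?G" ..
  \<comment> \<open>The intermediate level provides a point with f \<le> c' < c, hence the strict
    inequality inf f < c that the convexity assumption requires.\<close>
  obtain c' where c': "?G < ereal c'" "ereal c' < ereal c" using ereal_dense2[OF c(1)] by blast
  have "closure {\<xi>. f \<xi> \<le> ereal c'} \<noteq> {}" using g_closure[OF x c'(1)] by (rule ex_in_conv[THEN iffD1, OF exI])
  then obtain \<xi> where \<xi>: "f \<xi> \<le> ereal c'" unfolding closure_eq_empty by blast
  have "(INF \<xi>. f \<xi>) \<le> f \<xi>" by (rule INF_lower) simp
  also note \<xi>
  also note c'(2)
  finally have "(INF \<xi>. f \<xi>) < ereal c" .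
  then have C: "convex ?C" "interior ?C \<noteq> {}" using sub by auto
  then obtain A where A: "A \<in> interior ?C" by blast
  \<comment> \<open>The weights stay in (0, 1] and tend to 0; positivity is what moves points of the
    closure into the interior.\<close>
  define t :: "nat \<Rightarrow> real" where "t n = inverse (real (Suc n))" for n
  have t: "0 < t n" "t n \<le> 1" for n by (auto simp: t_def field_simps)
  define v where "v n x = (1 - t n) *\<^sub>R u x + t n *\<^sub>R (A *v x)" for n x
  have v: "v n \<in> W1infty \<Omega>" "AE x in ?M. ?D (v n) x = (1 - t n) *\<^sub>R ?D u x + t n *\<^sub>R A" for n
    using W1infty_add_linear[OF \<Omega> u] by (auto simp: v_def[abs_def])
  have "H (v n) \<le> ereal c" for n
  proof (rule H_le[OF v(1)])
    show "AE x in ?M. f (?D (v n) x) \<le> ereal c"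
      using v(2)[of n] AE_g
    proof eventually_elim
      case (elim x)
      \<comment> \<open>The gradient of \<open>u\<close> is only in the closure of the convex set {f
        \<le> c}; a proper step towards the interior point \<open>A\<close> reaches the interior,
        where f \<le> c holds for \<open>f\<close> itself.\<close>
      have "?D u x - t n *\<^sub>R (?D u x - A) \<in> interior ?C"
        by (rule mem_interior_closure_convex_shrink[OF C(1) A g_closure[OF elim(2) c(1)] t])
      moreover have "?D u x - t n *\<^sub>R (?D u x - A) = ?D (v n) x"
        unfolding elim(1) by (simp add: algebra_simps)
      ultimately show ?case using interior_subset by auto
    qed
  qed
  moreover have "limitin (W1infty_weak_star \<Omega>) v u sequentially"
    unfolding v_def[abs_def]
    by (rule limitin_convex_combination_linear[OF \<Omega> u]) (simp add: t_def LIMSEQ_inverse_real_of_nat del: of_nat_Suc)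
  moreover have "sequentially_closedin (W1infty_weak_star \<Omega>) {w \<in> W1infty \<Omega>. H w \<le> ereal c}"
  proof -
    have "sequentially_closedin (W1infty_weak_star \<Omega>) (W1infty \<Omega> - {w \<in> W1infty \<Omega>. ereal c < H w})"
      using H by (simp add: lower_semicontinuous_map_def openin_sequential_topology)
    moreover have "W1infty \<Omega> - {w \<in> W1infty \<Omega>. ereal c < H w} = {w \<in> W1infty \<Omega>. H w \<le> ereal c}"
      by auto
    ultimately show ?thesis by (simp only:)
  qed
  ultimately have "u \<in> {w \<in> W1infty \<Omega>. H w \<le> ereal c}"
    using v(1) unfolding sequentially_closedin_def by blast
  then show False using c(2) by (auto dest: leD)
qed

theorem theorem1p1:
  fixes \<Omega> :: "(real^'n::finite) set"
    and f :: "real^'n^'d::finite \<Rightarrow> ereal"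
    and u :: "real^'n \<Rightarrow> real^'d"
  assumes "open \<Omega>" and "bounded \<Omega>" and "lipschitz_boundary \<Omega>"
    and "f \<in> borel_measurable borel"
    and "\<And>c::real. (INF \<xi>. f \<xi>) < ereal c \<Longrightarrow>
           convex {\<xi>. f \<xi> \<le> ereal c} \<and> interior {\<xi>. f \<xi> \<le> ereal c} \<noteq> {}"
    and "u \<in> W1infty \<Omega>"
  shows "lsc_envelope (W1infty_weak_star \<Omega>) (supremal_functional \<Omega> f) u =
           lsc_envelope (sequential_topology (W1infty_weak_star \<Omega>)) (supremal_functional \<Omega> f) u \<and>
         lsc_envelope (sequential_topology (W1infty_weak_star \<Omega>)) (supremal_functional \<Omega> f) u =
           esssup (lebesgue_on \<Omega>) (\<lambda>x. lsc_envelope euclidean f (weak_gradient \<Omega> u x))"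
proof -
  let ?T = "W1infty_weak_star \<Omega> :: (real^'n \<Rightarrow> real^'d) topology" and ?F = "supremal_functional \<Omega> f"
  let ?g = "lsc_envelope euclidean f"
  let ?G = "\<lambda>u. esssup (lebesgue_on \<Omega>) (\<lambda>x. ?g (weak_gradient \<Omega> u x))"
  have closed: "closed {\<xi>. ?g \<xi> \<le> a}" for a
    unfolding sublevel_lsc_envelope by (intro closed_INT ballI closed_closure)
  have [measurable]: "?g \<in> borel_measurable borel"
    by (rule borel_measurableI_le) (use closed in auto)
  \<comment> \<open>The relaxed functional is a weakly* lower semicontinuous competitor. This starts
    a cycle of three inequalities through the two envelopes and back, which forces equality.\<close>
  have "?G u \<le> lsc_envelope ?T ?F u"
  proof (rule lsc_envelope_greatest)
    show "lower_semicontinuous_map ?T ?G"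
      using assms(5) by (intro lower_semicontinuous_map_esssup assms(1,2) closed convex_sublevel_lsc_envelope) auto
    fix v assume "v \<in> topspace ?T"
    then have [measurable]: "weak_gradient \<Omega> v \<in> borel_measurable (lebesgue_on \<Omega>)"
      using weak_gradient(1) by (auto simp: Linfty_def)
    show "?G v \<le> ?F v"
      unfolding supremal_functional_def by (rule esssup_mono) (auto intro: lsc_envelope_le)
  qed
  moreover have "lsc_envelope ?T ?F u \<le> lsc_envelope (sequential_topology ?T) ?F u"
    by (rule lsc_envelope_sequential_topology)
  moreover have "lsc_envelope (sequential_topology ?T) ?F u \<le> ?G u"
    unfolding lsc_envelope_def[of "sequential_topology ?T"]
    by (rule SUP_least, rule lower_semicontinuous_le_esssup) (use assms in auto)
  ultimately show ?thesis by (auto intro!: antisym intro: order_trans)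
qed

end
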